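(* Let $d=p^r$, where $p$ is a prime and $r\ge 2$ is an integer. The number of classes of non-equivalent actions of the representations $M_a$, $2\le a\le d-1$, of $\mathbb{Z}/d\mathbb{Z}$ on $K[x,y,z]_d$ is as follows: (1) if $p=2$ and $r=2$, there is only one class; if $p=2$ and $r>2$, there are $(d/4)+1$ classes, of which three classes have two elements and the remaining classes have $4$ elements; (2) if $p=3$ or $p=6n-1$ for some integer $n$, there are one class with three elements, $(d-p)/2p$ classes with $4$ elements and $(dp-2d-3p)/6p$ classes with six elements; (3) if $p=6n+1$ for some integer $n$, there are one class with three elements, one class with two elements, $(d-p)/2p$ classes with $4$ elements and $(dp-2d-5p)/6p$ classes with six elements.
   Context: $K$ is an algebraically closed field of characteristic zero, and $K[x,y,z]_d$ is the space of forms of degree $d$. Let $e\in K$ be a primitive $d$-th root of $1$. $M_a=\begin{pmatrix}1&0&0\\0&e&0\\0&0&e^a\end{pmatrix}$ acts by $x\mapsto x$, $y\mapsto ey$, $z\mapsto e^a z$. The actions of $M_a$ and $M_b$ on $K[x,y,z]_d$ are equivalent if the homogeneous artinian ideals generated by all forms of degree $d$ invariant under $M_a$, respectively $M_b$, coincide up to a permutation of the variables. A class is an equivalence class of this relation on the set of integers $a\in\{2,\dots,d-1\}$, and its number of elements is the number of such $a$ in it. The fractions $(d-p)/2p$, etc., mean $(d-p)/(2p)$, $(dp-2d-3p)/(6p)$, $(dp-2d-5p)/(6p)$. *)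

theory Defs
  imports
    "HOL-Analysis.Analysis"
    "HOL-Library.Poly_Mapping"
    "HOL-Computational_Algebra.Polynomial"
begin

text \<open>
  Polynomials over \<open>'k\<close> in the variables indexed by \<open>'n\<close>: finitely supported functions from
  exponent vectors to coefficients.  The ring structure is that of \<open>HOL-Library.Poly_Mapping\<close>.
  The variables \<open>x\<close>, \<open>y\<close>, \<open>z\<close> are those with index \<open>1\<close>, \<open>2\<close>, \<open>3\<close> of the numeral type \<open>3\<close>.
\<close>
type_synonym ('n, 'k) mpoly = "('n \<Rightarrow>\<^sub>0 nat) \<Rightarrow>\<^sub>0 'k"

definition Var :: "'n \<Rightarrow> ('n, 'k::comm_ring_1) mpoly" where
  "Var i = Poly_Mapping.single (Poly_Mapping.single i 1) 1"

definition Const :: "'k \<Rightarrow> ('n, 'k::comm_ring_1) mpoly" where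
  "Const c = Poly_Mapping.single 0 c"

text \<open>Simultaneous substitution of the polynomial \<open>\<sigma> i\<close> for each variable \<open>i\<close>.\<close>
definition subst :: "('n::finite \<Rightarrow> ('n, 'k::comm_ring_1) mpoly) \<Rightarrow> ('n, 'k) mpoly \<Rightarrow> ('n, 'k) mpoly" where
  "subst \<sigma> f =
     (\<Sum>m\<in>Poly_Mapping.keys f.
        Const (Poly_Mapping.lookup f m) * (\<Prod>i\<in>UNIV. \<sigma> i ^ Poly_Mapping.lookup m i))"

text \<open>As usual, the zero polynomial is a form of every degree.\<close>
definition is_form :: "nat \<Rightarrow> ('n::finite, 'k::zero) mpoly \<Rightarrow> bool" where
  "is_form d f \<longleftrightarrow> (\<forall>m\<in>Poly_Mapping.keys f. (\<Sum>i\<in>UNIV. Poly_Mapping.lookup m i) = d)"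

text \<open>The action by linear substitution; for a diagonal matrix, variable \<open>i\<close> goes to \<open>A $ i $ i\<close> times itself.\<close>
definition matrix_act :: "'k^'n^'n \<Rightarrow> ('n::finite, 'k::comm_ring_1) mpoly \<Rightarrow> ('n, 'k) mpoly" where
  "matrix_act A = subst (\<lambda>i. \<Sum>j\<in>UNIV. Const (A $ i $ j) * Var j)"

text \<open>Ideals of a commutative ring are its submodules, the ring acting on itself by multiplication.\<close>
lemma module_times: "module ((*) :: 'a::comm_ring_1 \<Rightarrow> 'a \<Rightarrow> 'a)"
  by unfold_locales (simp_all add: algebra_simps)

definition ideal_generated :: "'a::comm_ring_1 set \<Rightarrow> 'a set" where
  "ideal_generated S = module.span (*) S"

definition primitive_root_of_unity :: "nat \<Rightarrow> 'k::field \<Rightarrow> bool" where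
  "primitive_root_of_unity d e \<longleftrightarrow> 0 < d \<and> e ^ d = 1 \<and> (\<forall>k. 0 < k \<and> k < d \<longrightarrow> e ^ k \<noteq> 1)"

definition rep_matrix :: "'k::field \<Rightarrow> nat \<Rightarrow> 'k^3^3" where
  "rep_matrix e a = vector [vector [1, 0, 0], vector [0, e, 0], vector [0, 0, e ^ a]]"

definition invariant_ideal :: "nat \<Rightarrow> 'k::field \<Rightarrow> nat \<Rightarrow> (3, 'k) mpoly set" where
  "invariant_ideal d e a = ideal_generated {f. is_form d f \<and> matrix_act (rep_matrix e a) f = f}"

definition equivalent_actions :: "nat \<Rightarrow> 'k::field \<Rightarrow> nat \<Rightarrow> nat \<Rightarrow> bool" where
  "equivalent_actions d e a b \<longleftrightarrow>
     (\<exists>\<pi>::3 \<Rightarrow> 3. bij \<pi> \<and> subst (\<lambda>i. Var (\<pi> i)) ` invariant_ideal d e a = invariant_ideal d e b)"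

definition action_classes :: "nat \<Rightarrow> 'k::field \<Rightarrow> nat set set" where
  "action_classes d e =
     {2..d - 1} // {(a, b). a \<in> {2..d - 1} \<and> b \<in> {2..d - 1} \<and> equivalent_actions d e a b}"

definition classes_of_size :: "nat \<Rightarrow> 'k::field \<Rightarrow> nat \<Rightarrow> nat set set" where
  "classes_of_size d e n = {C \<in> action_classes d e. card C = n}"

end

theory Submission
  imports Defs "HOL-Number_Theory.Number_Theory"
begin

text \<open>
  The ideal of \<open>M\<^sub>a\<close> is spanned by monomials, and its part of degree \<open>d\<close> by the monomials
  \<open>x\<^sup>i y\<^sup>j z\<^sup>k\<close> with \<open>d dvd j + a k\<close>.  Among them is \<open>x^(a-1) y^(d-a) z\<close>, and where a permutation
  sends this one monomial already decides whether it carries one ideal to another.  Hence the action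
  of \<open>b\<close> is equivalent to that of \<open>a\<close> iff \<open>b\<close> is, modulo \<open>d\<close>, in the orbit
  \<open>a, 1 - a, 1/a, 1/(1 - a), (a - 1)/a, a/(a - 1)\<close> of the anharmonic group, where
  only fractions with invertible denominator count.

  For \<open>d = p^r\<close> the orbit has at most four elements if \<open>a \<equiv> 0\<close> or \<open>1\<close> modulo \<open>p\<close>.  Otherwise it has
  six, unless it is the orbit \<open>2, -1, 1/2\<close> or consists of the roots of \<open>a\<^sup>2 - a + 1\<close>, which
  exist only if \<open>p \<equiv> 1\<close> modulo \<open>6\<close>.  Counting elements by the size of their orbit gives the result.
\<close>

section \<open>Monomial ideals and permutations of the variables\<close>

lemma Const_times_Var_power:
  "(Const c * Var j :: ('n, 'k::comm_ring_1) mpoly) ^ n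
     = Poly_Mapping.single (Poly_Mapping.single j n) (c ^ n)"
proof (induction n)
  case (Suc n)
  have "(Const c * Var j :: ('n, 'k) mpoly) = Poly_Mapping.single (Poly_Mapping.single j 1) c"
    by (simp add: Const_def Var_def mult_single)
  with Suc show ?case
    by (simp add: mult_single single_add [symmetric])
qed simp

lemma prod_single:
  "(\<Prod>i\<in>I. Poly_Mapping.single (k i) (c i))
     = (Poly_Mapping.single (\<Sum>i\<in>I. k i) (\<Prod>i\<in>I. c i) :: ('a::comm_monoid_add \<Rightarrow>\<^sub>0 'k::comm_ring_1))"
  by (induction I rule: infinite_finite_induct) (simp_all add: mult_single)

lemma map_key_id: "Poly_Mapping.map_key id m = m"
  by (rule poly_mapping_eqI) (simp add: map_key.rep_eq)

lemma map_key_inv: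
  assumes "bij \<pi>"
  shows "Poly_Mapping.map_key \<pi> (Poly_Mapping.map_key (inv_into UNIV \<pi>) m) = m"
    and "Poly_Mapping.map_key (inv_into UNIV \<pi>) (Poly_Mapping.map_key \<pi> n) = n"
  using assms
  by (auto intro!: poly_mapping_eqI
      simp: map_key.rep_eq bij_is_inj bij_imp_bij_inv bij_is_surj surj_f_inv_f)

lemma map_key_inv_eq_iff:
  assumes "bij \<pi>"
  shows "Poly_Mapping.map_key (inv_into UNIV \<pi>) k = m \<longleftrightarrow> k = Poly_Mapping.map_key \<pi> m"
  using map_key_inv[OF assms] by metis

lemma sum_single_bij:
  fixes m :: "'n::finite \<Rightarrow>\<^sub>0 nat"
  assumes "bij \<pi>"
  shows "(\<Sum>i\<in>UNIV. Poly_Mapping.single (\<pi> i) (Poly_Mapping.lookup m i))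
     = Poly_Mapping.map_key (inv_into UNIV \<pi>) m"
proof (rule poly_mapping_eqI)
  fix j
  have "\<pi> i = j \<longleftrightarrow> i = inv_into UNIV \<pi> j" for i
    using assms by (metis bij_inv_eq_iff)
  then show "Poly_Mapping.lookup (\<Sum>i\<in>UNIV. Poly_Mapping.single (\<pi> i) (Poly_Mapping.lookup m i)) j
      = Poly_Mapping.lookup (Poly_Mapping.map_key (inv_into UNIV \<pi>) m) j"
    using assms
    by (simp add: lookup_sum lookup_single when_def map_key.rep_eq bij_imp_bij_inv bij_is_inj)
qed

text \<open>Monomials go to multiples of monomials, and since \<open>\<pi>\<close> is bijective only
  \<open>map_key \<pi> m\<close> is sent to a multiple of \<open>m\<close>. Trivial weights give a
  permutation of the variables, the identity permutation gives a diagonal matrix.\<close>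

lemma lookup_subst_monomial:
  fixes f :: "('n::finite, 'k::comm_ring_1) mpoly"
  assumes "bij \<pi>"
  shows "Poly_Mapping.lookup (subst (\<lambda>i. Const (w i) * Var (\<pi> i)) f) m
     = (\<Prod>i\<in>UNIV. w i ^ Poly_Mapping.lookup m (\<pi> i))
         * Poly_Mapping.lookup f (Poly_Mapping.map_key \<pi> m)"
proof -
  have "subst (\<lambda>i. Const (w i) * Var (\<pi> i)) f
      = (\<Sum>k\<in>Poly_Mapping.keys f. Poly_Mapping.single (Poly_Mapping.map_key (inv_into UNIV \<pi>) k)
          (Poly_Mapping.lookup f k * (\<Prod>i\<in>UNIV. w i ^ Poly_Mapping.lookup k i)))"
    unfolding subst_def Const_times_Var_power prod_single sum_single_bij[OF assms]
    by (simp add: Const_def mult_single)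
  then have "Poly_Mapping.lookup (subst (\<lambda>i. Const (w i) * Var (\<pi> i)) f) m
      = (\<Sum>k\<in>Poly_Mapping.keys f. if k = Poly_Mapping.map_key \<pi> m
           then Poly_Mapping.lookup f k * (\<Prod>i\<in>UNIV. w i ^ Poly_Mapping.lookup k i) else 0)"
    by (simp add: lookup_sum lookup_single when_def map_key_inv_eq_iff[OF assms])
  also have "\<dots> = (\<Prod>i\<in>UNIV. w i ^ Poly_Mapping.lookup m (\<pi> i))
         * Poly_Mapping.lookup f (Poly_Mapping.map_key \<pi> m)"
    using assms by (simp add: in_keys_iff map_key.rep_eq bij_is_inj mult.commute)
  finally show ?thesis .
qed

lemma subst_permutation:
  fixes f :: "('n::finite, 'k::comm_ring_1) mpoly"
  assumes "bij \<pi>"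
  shows "Poly_Mapping.lookup (subst (\<lambda>i. Var (\<pi> i)) f) m
     = Poly_Mapping.lookup f (Poly_Mapping.map_key \<pi> m)"
proof -
  have "(\<lambda>i. Var (\<pi> i)) = (\<lambda>i. Const 1 * (Var (\<pi> i) :: ('n, 'k) mpoly))"
    by (simp add: Const_def)
  then show ?thesis
    using lookup_subst_monomial[OF assms, of "\<lambda>_. 1" f m] by simp
qed

text \<open>The off-diagonal summands of the substitution vanish, so this is the weighted case with
  the identity permutation: each monomial is an eigenvector.\<close>

lemma lookup_matrix_act_rep_matrix:
  fixes f :: "(3, 'k::field) mpoly"
  shows "Poly_Mapping.lookup (matrix_act (rep_matrix e a) f) m
     = e ^ (Poly_Mapping.lookup m 2 + a * Poly_Mapping.lookup m 3) * Poly_Mapping.lookup f m"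
proof -
  define w :: "3 \<Rightarrow> 'k" where "w = (\<lambda>i. rep_matrix e a $ i $ i)"
  have w: "w 1 = 1" "w 2 = e" "w 3 = e ^ a"
    by (simp_all add: w_def rep_matrix_def)
  have C0: "Const 0 = (0 :: (3, 'k) mpoly)"
    by (simp add: Const_def)
  have "(\<Sum>j\<in>UNIV. Const (rep_matrix e a $ i $ j) * (Var j :: (3, 'k) mpoly)) = Const (w i) * Var (id i)" for i
    using exhaust_3[of i] by (elim disjE) (simp_all only: w sum_3 rep_matrix_def vector_3 C0 mult_zero_left add_0_left add_0_right id_apply)
  then have "matrix_act (rep_matrix e a) f = subst (\<lambda>i. Const (w i) * Var (id i)) f"
    by (simp only: matrix_act_def)
  then have "Poly_Mapping.lookup (matrix_act (rep_matrix e a) f) m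
      = (\<Prod>i\<in>UNIV. w i ^ Poly_Mapping.lookup m i) * Poly_Mapping.lookup f m"
    using lookup_subst_monomial[of id w f m] by (simp only: bij_id map_key_id id_apply simp_thms)
  moreover have "(\<Prod>i\<in>UNIV. w i ^ Poly_Mapping.lookup m i)
      = w 1 ^ Poly_Mapping.lookup m 1 * w 2 ^ Poly_Mapping.lookup m 2 * w 3 ^ Poly_Mapping.lookup m 3"
    unfolding UNIV_3 by (simp add: mult.assoc)
  ultimately show ?thesis
    by (simp only: w power_one mult_1_left power_add power_mult)
qed

lemma map_key_add:
  assumes "inj \<pi>"
  shows "Poly_Mapping.map_key \<pi> (u + v) = Poly_Mapping.map_key \<pi> u + Poly_Mapping.map_key \<pi> v"
  using assms by (intro poly_mapping_eqI) (simp add: map_key.rep_eq lookup_add)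

lemma sum_lookup_map_key:
  fixes m :: "'n::finite \<Rightarrow>\<^sub>0 nat"
  assumes "bij \<pi>"
  shows "(\<Sum>i\<in>UNIV. Poly_Mapping.lookup (Poly_Mapping.map_key \<pi> m) i)
     = (\<Sum>i\<in>UNIV. Poly_Mapping.lookup m i)"
  using sum.reindex_bij_betw[OF assms, of "Poly_Mapping.lookup m"] assms
  by (simp add: map_key.rep_eq bij_is_inj)

section \<open>Ideals generated by monomials\<close>

lemma subset_plus: "S \<subseteq> {u + s | u s. s \<in> S}" for S :: "'a::comm_monoid_add set"
  by (auto, metis add_0_left)

text \<open>The right side is an ideal because the support of a product lies in the sum of the
  supports; conversely each term of such an \<open>f\<close> is a multiple of a monomial in
  \<open>S\<close>. The generators are all polynomials supported in \<open>S\<close>, the shape in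
  which the invariant forms arise.\<close>

lemma ideal_generated_monomials:
  fixes S :: "('n \<Rightarrow>\<^sub>0 nat) set"
  shows "ideal_generated {f :: ('n, 'k::comm_ring_1) mpoly. Poly_Mapping.keys f \<subseteq> S}
     = {f. Poly_Mapping.keys f \<subseteq> {u + s | u s. s \<in> S}}" (is "?I = ?J")
proof (intro equalityI subsetI)
  interpret Modules.module "(*) :: ('n, 'k) mpoly \<Rightarrow> ('n, 'k) mpoly \<Rightarrow> ('n, 'k) mpoly"
    by (rule module_times)
  fix f :: "('n, 'k) mpoly"
  {
    have "subspace ?J"
    proof (rule subspaceI)
      fix c g :: "('n, 'k) mpoly"
      assume g: "g \<in> ?J"
      show "c * g \<in> ?J"
      proof (standard, rule subsetI)
        fix m assume "m \<in> Poly_Mapping.keys (c * g)"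
        then obtain a b where m: "m = a + b" "b \<in> Poly_Mapping.keys g"
          using keys_mult[of c g] by blast
        then obtain u s where "b = u + s" "s \<in> S"
          using g by blast
        with m have "m = (a + u) + s" "s \<in> S"
          by (simp_all add: add.assoc)
        then show "m \<in> {u + s | u s. s \<in> S}"
          by blast
      qed
    next
      fix g h :: "('n, 'k) mpoly"
      assume "g \<in> ?J" "h \<in> ?J"
      then show "g + h \<in> ?J"
        using Poly_Mapping.keys_add[of g h] by blast
    qed simp
    moreover have "{f. Poly_Mapping.keys f \<subseteq> S} \<subseteq> ?J"
      using subset_plus by blast
    moreover assume "f \<in> ?I"
    ultimately show "f \<in> ?J"
      unfolding ideal_generated_def using span_minimal by blast
  }
  {
    assume f: "f \<in> ?J"
    have "Poly_Mapping.single m (Poly_Mapping.lookup f m) \<in> span {f. Poly_Mapping.keys f \<subseteq> S}"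
      if m_keys: "m \<in> Poly_Mapping.keys f" for m
    proof -
      obtain u s where m: "m = u + s" "s \<in> S"
        using f m_keys by blast
      have "Poly_Mapping.single m (Poly_Mapping.lookup f m)
          = Poly_Mapping.single u (Poly_Mapping.lookup f m) * Poly_Mapping.single s 1"
        by (simp add: mult_single m(1))
      moreover have "Poly_Mapping.single s (1 :: 'k) \<in> {f. Poly_Mapping.keys f \<subseteq> S}"
        using m(2) by simp
      ultimately show ?thesis
        by (metis span_base span_scale)
    qed
    then have "(\<Sum>m\<in>Poly_Mapping.keys f. Poly_Mapping.single m (Poly_Mapping.lookup f m))
        \<in> span {f. Poly_Mapping.keys f \<subseteq> S}"
      by (rule span_sum)
    moreover have "(\<Sum>m\<in>Poly_Mapping.keys f. Poly_Mapping.single m (Poly_Mapping.lookup f m)) = f"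
      by (rule poly_mapping_eqI) (simp add: lookup_sum lookup_single when_def in_keys_iff)
    ultimately show "f \<in> ?I"
      by (simp add: ideal_generated_def)
  }
qed

section \<open>Invariant forms and their monomials\<close>

lemma primitive_root_power_eq_1_iff:
  assumes "primitive_root_of_unity d e"
  shows "e ^ n = 1 \<longleftrightarrow> d dvd n"
proof
  have d: "0 < d" "e ^ d = 1" "\<And>k. 0 < k \<Longrightarrow> k < d \<Longrightarrow> e ^ k \<noteq> 1"
    using assms by (auto simp: primitive_root_of_unity_def)
  {
    assume "e ^ n = 1"
    moreover have "e ^ n = e ^ (n mod d)"
      using d(2) by (metis div_mult_mod_eq mult_1 power_add power_mult power_one mult.commute)
    ultimately have "\<not> 0 < n mod d"
      using d by (metis mod_less_divisor)
    then show "d dvd n"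
      by (simp add: mod_eq_0_iff_dvd)
  }
  assume "d dvd n"
  then show "e ^ n = 1"
    using d(2) by (auto simp: power_mult elim!: dvdE)
qed

text \<open>For primitive \<open>e\<close> the eigenvalue of a monomial is 1 exactly if
  \<open>d\<close> divides the exponent of \<open>e\<close>; the field and the choice of
  \<open>e\<close> thereby disappear from the question.\<close>

definition invariant_monomials :: "nat \<Rightarrow> nat \<Rightarrow> (3 \<Rightarrow>\<^sub>0 nat) set" where
  "invariant_monomials d a = {m. (\<Sum>i\<in>UNIV. Poly_Mapping.lookup m i) = d \<and>
     d dvd Poly_Mapping.lookup m 2 + a * Poly_Mapping.lookup m 3}"

text \<open>The action rescales the coefficients one by one, so a form is fixed iff each of its
  monomials is.\<close>

lemma invariant_ideal_eq:
  fixes e :: "'k::field"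
  assumes "primitive_root_of_unity d e"
  shows "invariant_ideal d e a
     = {f. Poly_Mapping.keys f \<subseteq> {u + s | u s. s \<in> invariant_monomials d a}}"
proof -
  have "matrix_act (rep_matrix e a) f = f \<longleftrightarrow>
      (\<forall>m\<in>Poly_Mapping.keys f. d dvd Poly_Mapping.lookup m 2 + a * Poly_Mapping.lookup m 3)" for f
  proof -
    have "matrix_act (rep_matrix e a) f = f \<longleftrightarrow>
        (\<forall>m. Poly_Mapping.lookup (matrix_act (rep_matrix e a) f) m = Poly_Mapping.lookup f m)"
      by (metis poly_mapping_eqI)
    then show ?thesis
      unfolding lookup_matrix_act_rep_matrix mult_cancel_right2
        primitive_root_power_eq_1_iff[OF assms] by (metis in_keys_iff)
  qed
  then have "{f. is_form d f \<and> matrix_act (rep_matrix e a) f = f}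
      = {f. Poly_Mapping.keys f \<subseteq> invariant_monomials d a}"
    by (auto simp: is_form_def invariant_monomials_def)
  then show ?thesis
    by (simp only: invariant_ideal_def ideal_generated_monomials)
qed

text \<open>Every monomial in the support is \<open>u + s\<close> with \<open>s\<close> invariant of
  degree \<open>d\<close>; in degree \<open>d\<close> the cofactor \<open>u\<close> must be trivial.
  Thus the ideal determines its generating monomials.\<close>

lemma monomial_in_invariant_ideal:
  fixes e :: "'k::field"
  assumes "primitive_root_of_unity d e" "f \<in> invariant_ideal d e a"
    "m \<in> Poly_Mapping.keys f" "(\<Sum>i\<in>UNIV. Poly_Mapping.lookup m i) = d"
  shows "m \<in> invariant_monomials d a"
proof -
  obtain u s where m: "m = u + s" "s \<in> invariant_monomials d a"
    using assms(2,3) unfolding invariant_ideal_eq[OF assms(1)] by blast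
  then have "(\<Sum>i\<in>UNIV. Poly_Mapping.lookup u i) = 0"
    using assms(4) by (simp add: invariant_monomials_def lookup_add sum.distrib)
  then have "u = 0"
    by (intro poly_mapping_eqI) simp
  with m show ?thesis
    by simp
qed

lemma keys_subst_permutation:
  fixes f :: "('n::finite, 'k::comm_ring_1) mpoly"
  assumes "bij \<pi>"
  shows "Poly_Mapping.keys (subst (\<lambda>i. Var (\<pi> i)) f)
     = {m. Poly_Mapping.map_key \<pi> m \<in> Poly_Mapping.keys f}"
  by (simp add: set_eq_iff in_keys_iff subst_permutation[OF assms])

text \<open>Permuting variables preserves degrees, so an equality of ideals restricts to degree
  \<open>d\<close>, where only the generating monomials are left. Conversely \<open>map_key\<close>
  is additive and carries multiples to multiples.\<close>

lemma equivalent_actions_iff_monomials: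
  fixes e :: "'k::field"
  assumes "primitive_root_of_unity d e"
  shows "equivalent_actions d e a b \<longleftrightarrow> (\<exists>\<pi>. bij \<pi> \<and>
     (\<forall>m. m \<in> invariant_monomials d b \<longleftrightarrow> Poly_Mapping.map_key \<pi> m \<in> invariant_monomials d a))"
proof -
  note I = invariant_ideal_eq[OF assms]
  have "subst (\<lambda>i. Var (\<pi> i)) ` invariant_ideal d e a = invariant_ideal d e b \<longleftrightarrow>
      (\<forall>m. m \<in> invariant_monomials d b \<longleftrightarrow> Poly_Mapping.map_key \<pi> m \<in> invariant_monomials d a)"
    (is "?\<Phi> ` _ = _ \<longleftrightarrow> _") if \<pi>: "bij \<pi>" for \<pi> :: "3 \<Rightarrow> 3"
  proof
    have base: "Poly_Mapping.single m 1 \<in> invariant_ideal d e c"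
      if "m \<in> invariant_monomials d c" for m c
      using that subset_plus[of "invariant_monomials d c"] unfolding I by auto
    assume eq: "?\<Phi> ` invariant_ideal d e a = invariant_ideal d e b"
    show "\<forall>m. m \<in> invariant_monomials d b \<longleftrightarrow> Poly_Mapping.map_key \<pi> m \<in> invariant_monomials d a"
    proof (intro allI iffI)
      fix m assume m: "m \<in> invariant_monomials d b"
      obtain f where f: "f \<in> invariant_ideal d e a" "?\<Phi> f = Poly_Mapping.single m 1"
        using base[OF m] eq by (metis imageE)
      have "m \<in> Poly_Mapping.keys (?\<Phi> f)"
        by (simp add: f(2))
      then show "Poly_Mapping.map_key \<pi> m \<in> invariant_monomials d a"
        using m monomial_in_invariant_ideal[OF assms f(1)]
        by (simp add: keys_subst_permutation[OF \<pi>] sum_lookup_map_key[OF \<pi>] invariant_monomials_def)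
    next
      fix m assume m: "Poly_Mapping.map_key \<pi> m \<in> invariant_monomials d a"
      have "?\<Phi> (Poly_Mapping.single (Poly_Mapping.map_key \<pi> m) 1) \<in> invariant_ideal d e b"
        using base[OF m] eq by blast
      then show "m \<in> invariant_monomials d b"
        using m by (rule_tac monomial_in_invariant_ideal[OF assms])
          (auto simp: keys_subst_permutation[OF \<pi>] sum_lookup_map_key[OF \<pi>] invariant_monomials_def)
    qed
  next
    assume eq: "\<forall>m. m \<in> invariant_monomials d b \<longleftrightarrow>
      Poly_Mapping.map_key \<pi> m \<in> invariant_monomials d a"
    note \<pi>' = bij_imp_bij_inv[OF \<pi>]
    show "?\<Phi> ` invariant_ideal d e a = invariant_ideal d e b"
    proof (intro equalityI subsetI)
      fix g assume "g \<in> ?\<Phi> ` invariant_ideal d e a"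
      then obtain f where f: "f \<in> invariant_ideal d e a" "g = ?\<Phi> f"
        by blast
      show "g \<in> invariant_ideal d e b"
        unfolding I
      proof (standard, rule subsetI)
        fix m assume "m \<in> Poly_Mapping.keys g"
        then obtain u s where "Poly_Mapping.map_key \<pi> m = u + s" "s \<in> invariant_monomials d a"
          using f unfolding I by (auto simp: keys_subst_permutation[OF \<pi>])
        then have "m = Poly_Mapping.map_key (inv_into UNIV \<pi>) u + Poly_Mapping.map_key (inv_into UNIV \<pi>) s"
          "Poly_Mapping.map_key (inv_into UNIV \<pi>) s \<in> invariant_monomials d b"
          using \<pi> \<pi>' eq by (metis map_key_inv(2) map_key_add bij_is_inj, simp add: eq map_key_inv(1))
        then show "m \<in> {u + s | u s. s \<in> invariant_monomials d b}"
          by blast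
      qed
    next
      fix g assume g: "g \<in> invariant_ideal d e b"
      define f where "f = subst (\<lambda>i. Var (inv_into UNIV \<pi> i)) g"
      have "?\<Phi> f = g"
        by (rule poly_mapping_eqI)
          (simp add: f_def subst_permutation[OF \<pi>] subst_permutation[OF \<pi>'] map_key_inv(2)[OF \<pi>])
      moreover have "f \<in> invariant_ideal d e a"
        unfolding I
      proof (standard, rule subsetI)
        fix m assume "m \<in> Poly_Mapping.keys f"
        then obtain u s where "Poly_Mapping.map_key (inv_into UNIV \<pi>) m = u + s"
            "s \<in> invariant_monomials d b"
          using g unfolding I f_def by (auto simp: keys_subst_permutation[OF \<pi>'])
        then have "m = Poly_Mapping.map_key \<pi> u + Poly_Mapping.map_key \<pi> s"
          "Poly_Mapping.map_key \<pi> s \<in> invariant_monomials d a"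
          using \<pi> eq by (metis map_key_inv(1) map_key_add bij_is_inj, simp add: eq)
        then show "m \<in> {u + s | u s. s \<in> invariant_monomials d a}"
          by blast
      qed
      ultimately show "g \<in> ?\<Phi> ` invariant_ideal d e a"
        by blast
    qed
  qed
  then show ?thesis
    by (auto simp: equivalent_actions_def)
qed

section \<open>The anharmonic group\<close>

text \<open>The congruences say that \<open>b\<close> is one of \<open>a\<close>, \<open>1 - a\<close>, \<open>1 / a\<close>, \<open>1 / (1 - a)\<close>,
  \<open>(a - 1) / a\<close>, \<open>a / (a - 1)\<close>, written without divisions.\<close>
definition anharmonic :: "int \<Rightarrow> int \<Rightarrow> int \<Rightarrow> bool" where
  "anharmonic d a b \<longleftrightarrow> d dvd a - b \<or> d dvd a + b - 1 \<or> d dvd a * b - 1 \<or>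
     d dvd a * b - b + 1 \<or> d dvd a * b - a + 1 \<or> d dvd a * b - a - b"

section \<open>The six permutations of the variables and the six congruences\<close>

lemma exists_lookup_3:
  "\<exists>m :: 3 \<Rightarrow>\<^sub>0 nat. Poly_Mapping.lookup m 1 = x \<and> Poly_Mapping.lookup m 2 = y \<and> Poly_Mapping.lookup m 3 = z"
proof -
  define m :: "3 \<Rightarrow>\<^sub>0 nat" where "m = Abs_poly_mapping (\<lambda>i. vector [x, y, z] $ i)"
  have "Poly_Mapping.lookup m i = vector [x, y, z] $ i" for i
    by (simp add: m_def)
  then show ?thesis
    by (metis vector_3)
qed

lemma exists_permutation_3:
  fixes x y z :: 3
  assumes "x \<noteq> y" "x \<noteq> z" "y \<noteq> z"
  shows "\<exists>\<pi> :: 3 \<Rightarrow> 3. bij \<pi> \<and> \<pi> 1 = x \<and> \<pi> 2 = y \<and> \<pi> 3 = z"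
proof -
  define \<pi> where "\<pi> = (\<lambda>i::3. (vector [x, y, z] :: 3^3) $ i)"
  have \<pi>: "\<pi> 1 = x" "\<pi> 2 = y" "\<pi> 3 = z"
    by (simp_all only: \<pi>_def vector_3)
  have "i = j" if "\<pi> i = \<pi> j" for i j
    using exhaust_3[of i] exhaust_3[of j] that assms by (elim disjE) (simp_all only: \<pi>)
  then have "inj \<pi>"
    by (rule injI)
  then have "bij \<pi>"
    by (simp add: bij_def finite_UNIV_inj_surj)
  with \<pi> show ?thesis
    by blast
qed

text \<open>Giving a multiplier in each direction replaces a separate proof that one of them is a
  unit modulo \<open>d\<close>.\<close>

lemma dvd_iff_of_combination:
  fixes d :: int
  assumes "d dvd y - c * x" "d dvd x - c' * y"
  shows "d dvd x \<longleftrightarrow> d dvd y"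
  using assms by (metis diff_add_cancel dvd_add dvd_mult)

text \<open>As \<open>x + y + z\<close> vanishes modulo \<open>d\<close>, each relation makes the
  permuted form in \<open>a\<close> a unit multiple of \<open>y + b * z\<close>. The multipliers are
  \<open>1\<close>, \<open>-1\<close>, \<open>a\<close>, \<open>a - 1\<close>, \<open>- a\<close>,
  \<open>1 - a\<close>, with inverses \<open>1\<close>, \<open>-1\<close>, \<open>b\<close>,
  \<open>- b\<close>, \<open>b - 1\<close>, \<open>1 - b\<close>.\<close>

lemma anharmonic_invariants:
  fixes d a b x y z :: int
  assumes "x + y + z = d"
  shows "d dvd a - b \<Longrightarrow> d dvd y + b * z \<longleftrightarrow> d dvd y + a * z"
    and "d dvd a + b - 1 \<Longrightarrow> d dvd y + b * z \<longleftrightarrow> d dvd x + a * z"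
    and "d dvd a * b - 1 \<Longrightarrow> d dvd y + b * z \<longleftrightarrow> d dvd z + a * y"
    and "d dvd a * b - b + 1 \<Longrightarrow> d dvd y + b * z \<longleftrightarrow> d dvd x + a * y"
    and "d dvd a * b - a + 1 \<Longrightarrow> d dvd y + b * z \<longleftrightarrow> d dvd z + a * x"
    and "d dvd a * b - a - b \<Longrightarrow> d dvd y + b * z \<longleftrightarrow> d dvd y + a * x"
proof -
  have x: "x = d - y - z"
    using assms by simp
  \<comment> \<open>Here \<open>r\<close> is the relation between \<open>a\<close> and
    \<open>b\<close>, with coefficient \<open>q\<close>; \<open>t\<close> collects the multiples of
    \<open>d\<close> produced by eliminating \<open>x\<close>.\<close>
  have comb: "d dvd w" if "d dvd r" "w = q * r + d * t" for w q r t
    using that by simp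
  show "d dvd y + b * z \<longleftrightarrow> d dvd y + a * z" if R: "d dvd a - b"
  proof (rule dvd_iff_of_combination)
    show "d dvd y + a * z - 1 * (y + b * z)"
      by (rule comb[OF R, where q = "z" and t = "0"]) (simp add: x algebra_simps)
    show "d dvd (y + b * z) - 1 * (y + a * z)"
      by (rule comb[OF R, where q = "- z" and t = "0"]) (simp add: x algebra_simps)
  qed
  show "d dvd y + b * z \<longleftrightarrow> d dvd x + a * z" if R: "d dvd a + b - 1"
  proof (rule dvd_iff_of_combination)
    show "d dvd x + a * z - (- 1) * (y + b * z)"
      by (rule comb[OF R, where q = "z" and t = "1"]) (simp add: x algebra_simps)
    show "d dvd (y + b * z) - (- 1) * (x + a * z)"
      by (rule comb[OF R, where q = "z" and t = "1"]) (simp add: x algebra_simps)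
  qed
  show "d dvd y + b * z \<longleftrightarrow> d dvd z + a * y" if R: "d dvd a * b - 1"
  proof (rule dvd_iff_of_combination)
    show "d dvd z + a * y - a * (y + b * z)"
      by (rule comb[OF R, where q = "- z" and t = "0"]) (simp add: x algebra_simps)
    show "d dvd (y + b * z) - b * (z + a * y)"
      by (rule comb[OF R, where q = "- y" and t = "0"]) (simp add: x algebra_simps)
  qed
  show "d dvd y + b * z \<longleftrightarrow> d dvd x + a * y" if R: "d dvd a * b - b + 1"
  proof (rule dvd_iff_of_combination)
    show "d dvd x + a * y - (a - 1) * (y + b * z)"
      by (rule comb[OF R, where q = "- z" and t = "1"]) (simp add: x algebra_simps)
    show "d dvd (y + b * z) - (- b) * (x + a * y)"
      by (rule comb[OF R, where q = "y" and t = "b"]) (simp add: x algebra_simps)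
  qed
  show "d dvd y + b * z \<longleftrightarrow> d dvd z + a * x" if R: "d dvd a * b - a + 1"
  proof (rule dvd_iff_of_combination)
    show "d dvd z + a * x - (- a) * (y + b * z)"
      by (rule comb[OF R, where q = "z" and t = "a"]) (simp add: x algebra_simps)
    show "d dvd (y + b * z) - (b - 1) * (z + a * x)"
      by (rule comb[OF R, where q = "y + z" and t = "- (b - 1) * a"]) (simp add: x algebra_simps)
  qed
  show "d dvd y + b * z \<longleftrightarrow> d dvd y + a * x" if R: "d dvd a * b - a - b"
  proof (rule dvd_iff_of_combination)
    show "d dvd y + a * x - (1 - a) * (y + b * z)"
      by (rule comb[OF R, where q = "z" and t = "a"]) (simp add: x algebra_simps)
    show "d dvd (y + b * z) - (1 - b) * (y + a * x)"
      by (rule comb[OF R, where q = "- (y + z)" and t = "- (1 - b) * a"]) (simp add: x algebra_simps)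
  qed
qed

lemma equivalent_actions_iff_anharmonic:
  fixes e :: "'k::field"
  assumes e: "primitive_root_of_unity d e" and "b \<in> {2..d - 1}"
  shows "equivalent_actions d e a b \<longleftrightarrow> anharmonic (int d) (int a) (int b)"
proof -
  have b: "1 \<le> b" "b \<le> d"
    using assms(2) by auto
  have S: "m \<in> invariant_monomials d c \<longleftrightarrow>
      Poly_Mapping.lookup m 1 + Poly_Mapping.lookup m 2 + Poly_Mapping.lookup m 3 = d \<and>
      int d dvd int (Poly_Mapping.lookup m 2) + int c * int (Poly_Mapping.lookup m 3)" for m c
    unfolding invariant_monomials_def mem_Collect_eq sum_3
    by (metis of_nat_dvd_iff of_nat_add of_nat_mult)
  have lookup: "Poly_Mapping.lookup (Poly_Mapping.map_key \<pi> m) i = Poly_Mapping.lookup m (\<pi> i)"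
    if "bij \<pi>" for \<pi> :: "3 \<Rightarrow> 3" and m :: "3 \<Rightarrow>\<^sub>0 nat" and i
    using that by (simp add: map_key.rep_eq bij_is_inj)
  show ?thesis
  proof
    assume "equivalent_actions d e a b"
    then obtain \<pi> where \<pi>: "bij \<pi>" and iff: "\<And>m. m \<in> invariant_monomials d b \<Longrightarrow>
        Poly_Mapping.map_key \<pi> m \<in> invariant_monomials d a"
      unfolding equivalent_actions_iff_monomials[OF e] by blast
    \<comment> \<open>The test monomial \<open>x^(b-1) y^(d-b) z\<close> is invariant because
      \<open>(d - b) + b * 1 = d\<close>. Its permuted congruences are exactly the six
      relations.\<close>
    obtain m :: "3 \<Rightarrow>\<^sub>0 nat" where m: "Poly_Mapping.lookup m 1 = b - 1"
        "Poly_Mapping.lookup m 2 = d - b" "Poly_Mapping.lookup m 3 = 1"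
      using exists_lookup_3 by blast
    have "m \<in> invariant_monomials d b"
      unfolding S m using b by simp
    from iff[OF this] have dvd: "int d dvd int (Poly_Mapping.lookup m (\<pi> 2)) + int a * int (Poly_Mapping.lookup m (\<pi> 3))"
      unfolding S lookup[OF \<pi>] by simp
    have mi: "int (Poly_Mapping.lookup m 1) = int b - 1" "int (Poly_Mapping.lookup m 2) = int d - int b"
        "int (Poly_Mapping.lookup m 3) = 1"
      unfolding m using b by simp_all
    have neq: "\<pi> 2 \<noteq> \<pi> 3"
      using inj_eq[OF bij_is_inj[OF \<pi>], of 2 3] by simp
    have comb: "int d dvd w" if "int d dvd r" "w = q * r + int d * t" for w q r t
      using that by simp
    \<comment> \<open>The congruence sees the permutation only through \<open>\<pi> 2\<close> and
      \<open>\<pi> 3\<close>, whose six possible values correspond to the six fractions.\<close>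
    consider "\<pi> 2 = 2" "\<pi> 3 = 3" | "\<pi> 2 = 1" "\<pi> 3 = 3" | "\<pi> 2 = 3" "\<pi> 3 = 2"
      | "\<pi> 2 = 1" "\<pi> 3 = 2" | "\<pi> 2 = 3" "\<pi> 3 = 1" | "\<pi> 2 = 2" "\<pi> 3 = 1"
      using exhaust_3[of "\<pi> 2"] exhaust_3[of "\<pi> 3"] neq by metis
    then show "anharmonic (int d) (int a) (int b)"
    proof cases
      case 1
      have "int d dvd int a - int b"
        by (rule comb[OF dvd, where q = 1 and t = "- 1"]) (simp add: 1 mi)
      then show ?thesis by (simp add: anharmonic_def)
    next
      case 2
      have "int d dvd int a + int b - 1"
        by (rule comb[OF dvd, where q = 1 and t = 0]) (simp add: 2 mi)
      then show ?thesis by (simp add: anharmonic_def)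
    next
      case 3
      have "int d dvd int a * int b - 1"
        by (rule comb[OF dvd, where q = "- 1" and t = "int a"]) (simp add: 3 mi algebra_simps)
      then show ?thesis by (simp add: anharmonic_def)
    next
      case 4
      have "int d dvd int a * int b - int b + 1"
        by (rule comb[OF dvd, where q = "- 1" and t = "int a"]) (simp add: 4 mi algebra_simps)
      then show ?thesis by (simp add: anharmonic_def)
    next
      case 5
      have "int d dvd int a * int b - int a + 1"
        by (rule comb[OF dvd, where q = 1 and t = 0]) (simp add: 5 mi algebra_simps)
      then show ?thesis by (simp add: anharmonic_def)
    next
      case 6
      have "int d dvd int a * int b - int a - int b"
        by (rule comb[OF dvd, where q = 1 and t = "- 1"]) (simp add: 6 mi algebra_simps)
      then show ?thesis by (simp add: anharmonic_def)
    qed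
  next
    assume anh: "anharmonic (int d) (int a) (int b)"
    \<comment> \<open>\<open>i\<close>, \<open>j\<close>, \<open>k\<close> are the images of 1, 2,
      3, so the exponents at \<open>j\<close> and \<open>k\<close> take the places of those of
      \<open>y\<close> and \<open>z\<close>.\<close>
    have equiv: "equivalent_actions d e a b"
      if dist: "i \<noteq> j" "i \<noteq> k" "j \<noteq> k"
        and dvd: "\<And>m. Poly_Mapping.lookup m 1 + Poly_Mapping.lookup m 2 + Poly_Mapping.lookup m 3 = d \<Longrightarrow>
          int d dvd int (Poly_Mapping.lookup m 2) + int b * int (Poly_Mapping.lookup m 3) \<longleftrightarrow>
          int d dvd int (Poly_Mapping.lookup m j) + int a * int (Poly_Mapping.lookup m k)" for i j k :: 3
    proof -
      obtain \<pi> :: "3 \<Rightarrow> 3" where \<pi>: "bij \<pi>" "\<pi> 1 = i" "\<pi> 2 = j" "\<pi> 3 = k"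
        using exists_permutation_3[OF dist] by blast
      have "m \<in> invariant_monomials d b \<longleftrightarrow> Poly_Mapping.map_key \<pi> m \<in> invariant_monomials d a" for m
        using sum_lookup_map_key[OF \<pi>(1), of m] dvd[of m]
        unfolding S lookup[OF \<pi>(1)] sum_3 \<pi>(2-4) by metis
      with \<pi>(1) show ?thesis
        unfolding equivalent_actions_iff_monomials[OF e] by blast
    qed
    have neq: "(1 :: 3) \<noteq> 2" "(1 :: 3) \<noteq> 3" "(2 :: 3) \<noteq> 3"
      by simp_all
    have inv: "int (Poly_Mapping.lookup m 1) + int (Poly_Mapping.lookup m 2) + int (Poly_Mapping.lookup m 3) = int d"
      if "Poly_Mapping.lookup m 1 + Poly_Mapping.lookup m 2 + Poly_Mapping.lookup m 3 = d" for m :: "3 \<Rightarrow>\<^sub>0 nat"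
      using that by (metis of_nat_add)
    note inv = anharmonic_invariants[OF inv]
    show "equivalent_actions d e a b"
      using anh unfolding anharmonic_def
    proof (elim disjE)
      assume "int d dvd int a - int b"
      with neq inv(1) show ?thesis by (intro equiv[of 1 2 3]) blast+
    next
      assume "int d dvd int a + int b - 1"
      with neq inv(2) show ?thesis by (intro equiv[of 2 1 3]) metis+
    next
      assume "int d dvd int a * int b - 1"
      with neq inv(3) show ?thesis by (intro equiv[of 1 3 2]) metis+
    next
      assume "int d dvd int a * int b - int b + 1"
      with neq inv(4) show ?thesis by (intro equiv[of 3 1 2]) metis+
    next
      assume "int d dvd int a * int b - int a + 1"
      with neq inv(5) show ?thesis by (intro equiv[of 2 3 1]) metis+
    next
      assume "int d dvd int a * int b - int a - int b"
      with neq inv(6) show ?thesis by (intro equiv[of 3 2 1]) metis+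
    qed
  qed
qed

text \<open>Permutations can be inverted and composed. That the six congruences define an
  equivalence relation on the range is later read off from this, without computing with
  them.\<close>

lemma equiv_equivalent_actions:
  fixes e :: "'k::field"
  assumes "primitive_root_of_unity d e"
  shows "equiv {2..d - 1} {(a, b). a \<in> {2..d - 1} \<and> b \<in> {2..d - 1} \<and> equivalent_actions d e a b}"
    (is "equiv ?A ?r")
proof (rule equivI)
  note iff = equivalent_actions_iff_monomials[OF assms]
  show "?r \<subseteq> ?A \<times> ?A"
    by blast
  have "equivalent_actions d e a a" for a
    unfolding iff by (rule exI[of _ id]) (simp add: map_key_id)
  then show "refl_on ?A ?r"
    by (auto simp: refl_on_def)
  have "equivalent_actions d e b a" if "equivalent_actions d e a b" for a b
    using that unfolding iff by (metis bij_imp_bij_inv map_key_inv(1))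
  then show "sym ?r"
    by (auto simp: sym_def)
  have "equivalent_actions d e a c" if abc: "equivalent_actions d e a b" "equivalent_actions d e b c" for a b c
  proof -
    obtain \<pi> \<rho> where \<pi>: "bij \<pi>" "\<And>m. m \<in> invariant_monomials d b \<longleftrightarrow> Poly_Mapping.map_key \<pi> m \<in> invariant_monomials d a"
      and \<rho>: "bij \<rho>" "\<And>m. m \<in> invariant_monomials d c \<longleftrightarrow> Poly_Mapping.map_key \<rho> m \<in> invariant_monomials d b"
      using abc unfolding iff by blast
    \<comment> \<open>\<open>map_key\<close> reverses the order of composition.\<close>
    have "bij (\<rho> \<circ> \<pi>)"
      using \<pi>(1) \<rho>(1) by (rule bij_comp)
    moreover have "Poly_Mapping.map_key (\<rho> \<circ> \<pi>) m = Poly_Mapping.map_key \<pi> (Poly_Mapping.map_key \<rho> m)" for m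
      using \<pi>(1) \<rho>(1) calculation by (intro poly_mapping_eqI) (simp add: map_key.rep_eq bij_is_inj)
    ultimately show ?thesis
      unfolding iff using \<pi>(2) \<rho>(2) by metis
  qed
  then show "trans ?r"
    by (auto simp: trans_def)
qed

section \<open>Classes modulo a prime power\<close>

text \<open>The parameters are natural numbers, but the orbit is computed with integers such as
  \<open>1 - a\<close>; for positive \<open>d\<close> this picks the representative in
  \<open>{0..<d}\<close>.\<close>

definition residue :: "nat \<Rightarrow> int \<Rightarrow> nat" where
  "residue d x = nat (x mod int d)"

definition anharmonic_class :: "nat \<Rightarrow> nat \<Rightarrow> nat set" where
  "anharmonic_class d a = {b \<in> {2..d - 1}. anharmonic (int d) (int a) (int b)}"

text \<open>In this form every congruence either fixes \<open>b\<close> itself or makes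
  \<open>b\<close> or \<open>1 - b\<close> inverse to \<open>a\<close> or \<open>1 - a\<close>, so
  each can be solved for \<open>b\<close>.\<close>

lemma anharmonic_alt:
  "anharmonic d a b \<longleftrightarrow> d dvd b - a \<or> d dvd b - (1 - a) \<or> d dvd a * b - 1 \<or>
     d dvd (1 - a) * b - 1 \<or> d dvd a * (1 - b) - 1 \<or> d dvd (1 - a) * (1 - b) - 1"
proof -
  have "d dvd a - b \<longleftrightarrow> d dvd b - a"
    by (rule dvd_diff_commute)
  moreover have "d dvd a * b - b + 1 \<longleftrightarrow> d dvd (1 - a) * b - 1"
    using dvd_minus_iff[of d "(1 - a) * b - 1"] by (simp add: algebra_simps)
  moreover have "d dvd a * b - a + 1 \<longleftrightarrow> d dvd a * (1 - b) - 1"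
    using dvd_minus_iff[of d "a * (1 - b) - 1"] by (simp add: algebra_simps)
  moreover have "(1 - a) * (1 - b) - 1 = a * b - a - b" "b - (1 - a) = a + b - 1"
    by (simp_all add: algebra_simps)
  ultimately show ?thesis
    unfolding anharmonic_def by metis
qed

lemma residue_eq_iff:
  "0 < d \<Longrightarrow> residue d x = residue d y \<longleftrightarrow> int d dvd x - y"
  by (simp add: residue_def nat_eq_iff mod_eq_dvd_iff)

lemma residue_of_nat: "b < d \<Longrightarrow> residue d (int b) = b"
  by (simp add: residue_def flip: zmod_int)

lemma residue_mem:
  assumes "0 < d" "\<not> int d dvd x" "\<not> int d dvd x - 1"
  shows "residue d x \<in> {2..d - 1}"
proof -
  define y where "y = x mod int d"
  have "y \<noteq> 0" "0 \<le> y" "y < int d"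
    using assms by (auto simp: y_def dvd_eq_mod_eq_0)
  moreover have "y \<noteq> 1"
    using assms(3) by (metis dvd_minus_mod y_def)
  ultimately show ?thesis
    by (auto simp: residue_def simp flip: y_def)
qed

text \<open>Uniqueness of inverses modulo \<open>d\<close>, used to solve the product congruences of
  \<open>anharmonic_alt\<close>.\<close>

lemma dvd_inverse_iff:
  fixes d :: int
  assumes "d dvd u * c - 1"
  shows "d dvd c * x - 1 \<longleftrightarrow> d dvd x - u"
proof
  assume "d dvd c * x - 1"
  then have "d dvd u * (c * x - 1) - x * (u * c - 1)"
    using assms by (simp only: dvd_diff dvd_mult)
  then show "d dvd x - u"
    by (simp add: algebra_simps)
next
  assume "d dvd x - u"
  then have "d dvd c * (x - u) + (u * c - 1)"
    using assms by (simp only: dvd_add dvd_mult)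
  then show "d dvd c * x - 1"
    by (simp add: algebra_simps)
qed

text \<open>The classes with \<open>k\<close> elements are disjoint, and their union consists of the
  elements whose class has \<open>k\<close> elements. Counting classes becomes counting
  elements.\<close>

lemma card_classes_of_card:
  assumes "finite A" "equiv A r"
  shows "k * card {C \<in> A // r. card C = k} = card {a \<in> A. card (r `` {a}) = k}"
proof -
  have "\<Union> {C \<in> A // r. card C = k} = {a \<in> A. card (r `` {a}) = k}"
  proof (intro equalityI subsetI)
    fix a assume "a \<in> \<Union> {C \<in> A // r. card C = k}"
    then obtain C where C: "C \<in> A // r" "card C = k" "a \<in> C"
      by blast
    then have "a \<in> A" "C = r `` {a}"
      using assms(2) by (metis UnionI Union_quotient, metis Image_singleton_iff equiv_class_eq quotientE)
    with C show "a \<in> {a \<in> A. card (r `` {a}) = k}"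
      by simp
  next
    fix a assume "a \<in> {a \<in> A. card (r `` {a}) = k}"
    then show "a \<in> \<Union> {C \<in> A // r. card C = k}"
      using equiv_class_self[OF assms(2)] by (auto intro: quotientI)
  qed
  moreover have "k * card {C \<in> A // r. card C = k} = card (\<Union> {C \<in> A // r. card C = k})"
  proof (rule card_partition)
    show "finite {C \<in> A // r. card C = k}"
      using finite_quotient[OF assms(1) equiv_type[OF assms(2)]] by simp
    show "finite (\<Union> {C \<in> A // r. card C = k})"
      unfolding calculation using assms(1) by simp
    show "C \<inter> C' = {}" if "C \<in> {C \<in> A // r. card C = k}" "C' \<in> {C \<in> A // r. card C = k}" "C \<noteq> C'" for C C'
      using that quotient_disj[OF assms(2)] by blast
  qed simp
  ultimately show ?thesis
    by simp
qed

section \<open>Orbits modulo a prime power and their sizes\<close>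

locale prime_power =
  fixes p r d :: nat
  assumes prime: "prime p" and r: "r \<ge> 2" and d: "d = p ^ r"
begin

lemma d_pos: "0 < d" and d_gt_1: "1 < d" and p_dvd_d: "int p dvd int d"
proof -
  show "1 < d"
    using prime r d by (metis One_nat_def one_less_power prime_gt_Suc_0_nat less_le_trans zero_less_numeral)
  then show "0 < d"
    by simp
  show "int p dvd int d"
    using r d by (simp add: dvd_power)
qed

lemma prime_int: "prime (int p)"
  using prime by simp

lemma p_dvd: "int d dvd x \<Longrightarrow> int p dvd x"
  using p_dvd_d dvd_trans by blast

lemma not_p_dvd_1: "\<not> int p dvd 1"
  using prime_int not_prime_unit by blast

lemma not_d_dvd_1: "\<not> int d dvd 1"
  using not_p_dvd_1 p_dvd by blast

lemma coprime_d: "\<not> int p dvd x \<Longrightarrow> coprime (int d) x"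
  using prime_imp_coprime[OF prime_int] d by simp

text \<open>Modulo a power of \<open>p\<close> an integer prime to \<open>p\<close> is a
  unit.\<close>

lemma dvd_cancel: "int d dvd x * y \<Longrightarrow> \<not> int p dvd y \<Longrightarrow> int d dvd x"
  using coprime_d by (simp add: coprime_dvd_mult_left_iff)

lemma inverse_exists:
  assumes "\<not> int p dvd c"
  obtains u where "int d dvd u * c - 1"
proof -
  have "coprime c (int d)"
    using coprime_d[OF assms] by (simp add: coprime_commute)
  then obtain u where "[c * u = 1] (mod int d)"
    using cong_solve_coprime_int by blast
  then show ?thesis
    using that by (simp add: cong_iff_dvd_diff mult.commute)
qed

text \<open>The range \<open>{2..d - 1}\<close> omits exactly the residues 0 and 1. An inverse is
  never 0, and it is 1 only if \<open>c\<close> is; passing to \<open>1 - u\<close> swaps the two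
  omitted residues.\<close>

lemma residue_inverse_mem:
  assumes "int d dvd u * c - 1" "\<not> int d dvd c - 1"
  shows "residue d u \<in> {2..d - 1}" "residue d (1 - u) \<in> {2..d - 1}"
proof -
  have 0: "\<not> int d dvd u"
  proof
    assume "int d dvd u"
    then have "int d dvd u * c - (u * c - 1)"
      using assms(1) by (simp only: dvd_diff dvd_mult2)
    then show False
      using not_d_dvd_1 by simp
  qed
  have 1: "\<not> int d dvd u - 1"
  proof
    assume "int d dvd u - 1"
    then have "int d dvd (u * c - 1) - (u - 1) * c"
      using assms(1) by (simp only: dvd_diff dvd_mult2)
    then show False
      using assms(2) by (simp add: algebra_simps)
  qed
  show "residue d u \<in> {2..d - 1}"
    using d_pos 0 1 by (rule residue_mem)
  show "residue d (1 - u) \<in> {2..d - 1}"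
    using d_pos 0 1 dvd_minus_iff[of "int d" u] dvd_diff_commute[of "int d" u 1]
    by (intro residue_mem) simp_all
qed

lemma not_dvd_range:
  assumes "a \<in> {2..d - 1}"
  shows "\<not> int d dvd int a" "\<not> int d dvd int a - 1" "\<not> int d dvd (1 - int a) - 1"
proof -
  have a: "2 \<le> int a" "int a < int d"
    using assms d_gt_1 by auto
  show "\<not> int d dvd int a" "\<not> int d dvd int a - 1"
    using a zdvd_not_zless[of "int a" "int d"] zdvd_not_zless[of "int a - 1" "int d"] by auto
  then show "\<not> int d dvd (1 - int a) - 1"
    by simp
qed

lemma residue_range_mem:
  assumes "a \<in> {2..d - 1}"
  shows "residue d (int a) \<in> {2..d - 1}" "residue d (1 - int a) \<in> {2..d - 1}"
  using d_pos not_dvd_range[OF assms] dvd_diff_commute[of "int d" "int a" 1]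
  by (metis residue_mem)+

lemma residue_iff:
  assumes "b \<in> {2..d - 1}"
  shows "int d dvd int b - x \<longleftrightarrow> b = residue d x"
proof -
  have "residue d (int b) = b"
    using assms d_gt_1 by (intro residue_of_nat) auto
  then show ?thesis
    using residue_eq_iff[OF d_pos, of "int b" x] by simp
qed

lemma reflect_residue_iff:
  assumes "b \<in> {2..d - 1}"
  shows "int d dvd (1 - int b) - x \<longleftrightarrow> b = residue d (1 - x)"
proof -
  have "int d dvd (1 - int b) - x \<longleftrightarrow> int d dvd int b - (1 - x)"
    by (subst dvd_diff_commute) (simp add: algebra_simps)
  then show ?thesis
    using residue_iff[OF assms] by simp
qed

text \<open>\<open>u\<close> and \<open>v\<close> stand for \<open>1/a\<close> and
  \<open>1/(1 - a)\<close>, hence \<open>1 - u\<close> and \<open>1 - v\<close> for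
  \<open>(a - 1)/a\<close> and \<open>a/(a - 1)\<close>. All six fractions exist, possibly with
  repetitions.\<close>

lemma anharmonic_class_unit:
  assumes a: "a \<in> {2..d - 1}" and u: "int d dvd u * int a - 1" and v: "int d dvd v * (1 - int a) - 1"
  shows "anharmonic_class d a = {residue d (int a), residue d (1 - int a),
     residue d u, residue d (1 - u), residue d v, residue d (1 - v)}" (is "_ = ?X")
proof -
  have "?X \<subseteq> {2..d - 1}"
    using residue_range_mem[OF a] residue_inverse_mem[OF u] residue_inverse_mem[OF v]
      not_dvd_range[OF a] by simp
  moreover have "anharmonic (int d) (int a) (int b) \<longleftrightarrow> b \<in> ?X" if "b \<in> {2..d - 1}" for b
    unfolding anharmonic_alt dvd_inverse_iff[OF u] dvd_inverse_iff[OF v]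
      residue_iff[OF that] reflect_residue_iff[OF that] by blast
  ultimately show ?thesis
    unfolding anharmonic_class_def by blast
qed

text \<open>An inverse of \<open>a\<close> would make \<open>p\<close> divide 1, so the two
  congruences of \<open>anharmonic_alt\<close> with the factor \<open>a\<close> have no solution,
  and four fractions remain.\<close>

lemma anharmonic_class_nonunit:
  assumes a: "a \<in> {2..d - 1}" "int p dvd int a" and u: "int d dvd u * (1 - int a) - 1"
  shows "anharmonic_class d a = {residue d (int a), residue d (1 - int a),
     residue d u, residue d (1 - u)}" (is "_ = ?X")
proof -
  have "?X \<subseteq> {2..d - 1}"
    using residue_range_mem[OF a(1)] residue_inverse_mem[OF u] not_dvd_range[OF a(1)] by simp
  moreover have "\<not> int d dvd int a * c - 1" for c
  proof
    assume "int d dvd int a * c - 1"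
    then have "int p dvd int a * c - (int a * c - 1)"
      using a(2) p_dvd by (simp only: dvd_diff dvd_mult2)
    then show False
      using not_p_dvd_1 by simp
  qed
  then have "anharmonic (int d) (int a) (int b) \<longleftrightarrow> b \<in> ?X" if "b \<in> {2..d - 1}" for b
    unfolding anharmonic_alt dvd_inverse_iff[OF u]
      residue_iff[OF that] reflect_residue_iff[OF that] by blast
  ultimately show ?thesis
    unfolding anharmonic_class_def by blast
qed

text \<open>Modulo \<open>p\<close> the elements \<open>a\<close>, \<open>1 - a\<close>,
  \<open>u\<close>, \<open>1 - u\<close> are 0, 1, 1, 0. The only possible coincidences are
  \<open>1 - a\<close> with \<open>u\<close> and \<open>a\<close> with \<open>1 - u\<close>, and
  both say \<open>(1 - a)^2 = 1\<close> modulo \<open>d\<close>.\<close>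

lemma card_anharmonic_class_nonunit:
  assumes a: "a \<in> {2..d - 1}" "int p dvd int a"
  shows "card (anharmonic_class d a) = (if int d dvd int a * (int a - 2) then 2 else 4)"
proof -
  let ?a = "int a"
  have p1: "\<not> int p dvd 1 - ?a"
    using a(2) not_p_dvd_1 by (metis diff_add_cancel dvd_add)
  then obtain u where u: "int d dvd u * (1 - ?a) - 1"
    by (rule inverse_exists)
  \<comment> \<open>Divisibility of \<open>x\<close> by \<open>d\<close> is refuted by writing 1 as
    a combination of \<open>x\<close>, \<open>a\<close> and \<open>u * (1 - a) - 1\<close>, all of
    which \<open>p\<close> would divide.\<close>
  have no: False if "int d dvd x" "1 = s * x + t * ?a + k * (u * (1 - ?a) - 1)" for x s t k
  proof -
    have "int p dvd s * x + t * ?a + k * (u * (1 - ?a) - 1)"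
      using that(1) a(2) u p_dvd by (simp only: dvd_add dvd_mult)
    then show False
      using that(2) not_p_dvd_1 by simp
  qed
  have ne: "\<not> int d dvd ?a - (1 - ?a)" "\<not> int d dvd ?a - u" "\<not> int d dvd u - (1 - u)"
    by (rule notI, erule no[where s = "- 1" and t = 2 and k = 0], simp add: algebra_simps,
        rule notI, erule no[where s = "- 1" and t = "1 - u" and k = "- 1"], simp add: algebra_simps,
        rule notI, erule no[where s = 1 and t = "- 2 * u" and k = "- 2"], simp add: algebra_simps)
  have iff: "int d dvd (1 - ?a) - u \<longleftrightarrow> int d dvd ?a * (?a - 2)"
    unfolding dvd_inverse_iff[OF u, symmetric] by (simp add: algebra_simps)
  have eq: "residue d ?a \<noteq> residue d (1 - ?a)" "residue d ?a \<noteq> residue d u"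
     "residue d (1 - ?a) \<noteq> residue d (1 - u)" "residue d u \<noteq> residue d (1 - u)"
     "residue d (1 - ?a) = residue d u \<longleftrightarrow> int d dvd ?a * (?a - 2)"
     "residue d ?a = residue d (1 - u) \<longleftrightarrow> int d dvd ?a * (?a - 2)"
    using ne dvd_diff_commute[of "int d" ?a u] dvd_diff_commute[of "int d" "1 - ?a" u]
    unfolding residue_eq_iff[OF d_pos] iff[symmetric] by (simp_all add: algebra_simps)
  show ?thesis
  proof (cases "int d dvd ?a * (?a - 2)")
    case True
    with eq show ?thesis
      unfolding anharmonic_class_nonunit[OF a u] by (simp add: insert_commute)
  next
    case False
    with eq show ?thesis
      unfolding anharmonic_class_nonunit[OF a u] by simp
  qed
qed

text \<open>Clearing denominators turns each of the fifteen possible coincidences among the six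
  fractions into an excluded congruence, up to unit factors. The linear ones belong to the
  involutions \<open>1 - a\<close>, \<open>1/a\<close>, \<open>a/(a - 1)\<close>, the quadratic one
  to the maps of order three.\<close>

lemma card_anharmonic_class_unit:
  assumes a: "a \<in> {2..d - 1}" "\<not> int p dvd int a" "\<not> int p dvd int a - 1"
    and generic: "\<not> int d dvd 2 * int a - 1" "\<not> int d dvd int a + 1" "\<not> int d dvd int a - 2"
      "\<not> int d dvd (int a)\<^sup>2 - int a + 1"
  shows "card (anharmonic_class d a) = 6"
proof -
  let ?a = "int a"
  have p1: "\<not> int p dvd 1 - ?a"
    using a(3) by (simp add: dvd_diff_commute)
  obtain u v where u: "int d dvd u * ?a - 1" and v: "int d dvd v * (1 - ?a) - 1"
    using inverse_exists[OF a(2)] inverse_exists[OF p1] by metis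
  \<comment> \<open>\<open>x\<close> is a difference of two fractions and \<open>m\<close> clears
    its denominators; \<open>s\<close> and \<open>t\<close> correct by the defining relations of
    \<open>u\<close> and \<open>v\<close>, leaving \<open>y\<close>.\<close>
  have comb: "\<not> int d dvd x" if "\<not> int d dvd y" "y = m * x + s * (u * ?a - 1) + t * (v * (1 - ?a) - 1)" for x y m s t
  proof
    assume "int d dvd x"
    then have "int d dvd y"
      unfolding that(2) using u v by (simp only: dvd_add dvd_mult)
    with that(1) show False
      by simp
  qed
  \<comment> \<open>\<open>a = 1/a\<close> leads to \<open>a^2 - 1\<close>, and
    \<open>a = a/(a - 1)\<close> to \<open>a * (a - 2)\<close>; the unit factors
    \<open>a - 1\<close> and \<open>a\<close> are cancelled.\<close>
  have g2: "\<not> int d dvd (?a + 1) * (?a - 1)"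
    using generic(2) dvd_cancel a(3) by blast
  have g3: "\<not> int d dvd (?a - 2) * ?a"
    using generic(3) dvd_cancel a(2) by blast
  have "\<not> int d dvd ?a - (1 - ?a)"
    by (rule comb[OF generic(1), where m = 1 and s = 0 and t = 0]) simp
  moreover have "\<not> int d dvd ?a - u"
    by (rule comb[OF g2, where m = ?a and s = 1 and t = 0])
      (simp add: algebra_simps power2_eq_square)
  moreover have "\<not> int d dvd ?a - (1 - u)"
    by (rule comb[OF generic(4), where m = ?a and s = "- 1" and t = 0])
      (simp add: algebra_simps power2_eq_square)
  moreover have "\<not> int d dvd ?a - v"
    by (rule comb[OF generic(4), where m = "?a - 1" and s = 0 and t = "- 1"])
      (simp add: algebra_simps power2_eq_square)
  moreover have "\<not> int d dvd ?a - (1 - v)"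
    by (rule comb[OF g3, where m = "?a - 1" and s = 0 and t = 1])
      (simp add: algebra_simps power2_eq_square)
  moreover have "\<not> int d dvd (1 - ?a) - u"
    by (rule comb[OF generic(4), where m = "- ?a" and s = "- 1" and t = 0])
      (simp add: algebra_simps power2_eq_square)
  moreover have "\<not> int d dvd (1 - ?a) - (1 - u)"
    by (rule comb[OF g2, where m = "- ?a" and s = 1 and t = 0])
      (simp add: algebra_simps power2_eq_square)
  moreover have "\<not> int d dvd (1 - ?a) - v"
    by (rule comb[OF g3, where m = "1 - ?a" and s = 0 and t = 1])
      (simp add: algebra_simps power2_eq_square)
  moreover have "\<not> int d dvd (1 - ?a) - (1 - v)"
    by (rule comb[OF generic(4), where m = "1 - ?a" and s = 0 and t = "- 1"])
      (simp add: algebra_simps power2_eq_square)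
  moreover have "\<not> int d dvd u - (1 - u)"
    by (rule comb[OF generic(3), where m = "- ?a" and s = 2 and t = 0])
      (simp add: algebra_simps power2_eq_square)
  moreover have "\<not> int d dvd u - v"
    by (rule comb[OF generic(1), where m = "- ?a * (1 - ?a)" and s = "1 - ?a" and t = "- ?a"])
      (simp add: algebra_simps power2_eq_square)
  moreover have "\<not> int d dvd u - (1 - v)"
    by (rule comb[OF generic(4), where m = "?a * (1 - ?a)" and s = "?a - 1" and t = "- ?a"])
      (simp add: algebra_simps power2_eq_square)
  moreover have "\<not> int d dvd (1 - u) - v"
    by (rule comb[OF generic(4), where m = "- ?a * (1 - ?a)" and s = "?a - 1" and t = "- ?a"])
      (simp add: algebra_simps power2_eq_square)
  moreover have "\<not> int d dvd (1 - u) - (1 - v)"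
    by (rule comb[OF generic(1), where m = "?a * (1 - ?a)" and s = "1 - ?a" and t = "- ?a"])
      (simp add: algebra_simps power2_eq_square)
  moreover have "\<not> int d dvd v - (1 - v)"
    by (rule comb[OF generic(2), where m = "1 - ?a" and s = 0 and t = "- 2"])
      (simp add: algebra_simps power2_eq_square)
  ultimately show ?thesis
    unfolding anharmonic_class_unit[OF a(1) u v] residue_eq_iff[OF d_pos, symmetric]
    by simp
qed

end

section \<open>Primitive sixth roots of unity and the class of 2\<close>

lemma dvd_quadratic_cube:
  fixes m x :: int
  assumes "m dvd x\<^sup>2 - x + 1"
  shows "[x ^ 3 = -1] (mod m)"
proof -
  have "x ^ 3 - (-1) = (x + 1) * (x\<^sup>2 - x + 1)"
    by (simp add: algebra_simps power2_eq_square power3_eq_cube)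
  with assms show ?thesis
    by (simp add: cong_iff_dvd_diff)
qed

text \<open>\<open>4 * (x^2 - x + 1) = (2 * x - 1)^2 + 3\<close>: if 3 divides the left side then 9
  divides the square, so 9 cannot divide the sum.\<close>

lemma nine_not_dvd_quadratic: "\<not> 9 dvd x\<^sup>2 - x + 1" for x :: int
proof
  assume 9: "9 dvd x\<^sup>2 - x + 1"
  have eq: "(2 * x - 1)\<^sup>2 = 4 * (x\<^sup>2 - x + 1) - 3"
    by (simp add: algebra_simps power2_eq_square)
  have "(3::int) dvd 9"
    by simp
  then have "3 dvd x\<^sup>2 - x + 1"
    using 9 dvd_trans by blast
  then have "3 dvd (2 * x - 1)\<^sup>2"
    unfolding eq by (simp only: dvd_diff dvd_mult dvd_refl)
  moreover have "prime (3::int)"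
    by simp
  ultimately have "3 dvd 2 * x - 1"
    using prime_dvd_power by blast
  then have "3\<^sup>2 dvd (2 * x - 1)\<^sup>2"
    by (rule dvd_power_same)
  then have "9 dvd 4 * (x\<^sup>2 - x + 1) - 3"
    unfolding eq by simp
  with 9 have "9 dvd 4 * (x\<^sup>2 - x + 1) - (4 * (x\<^sup>2 - x + 1) - 3)"
    by (simp only: dvd_diff dvd_mult)
  then show False
    by simp
qed

text \<open>A root satisfies \<open>a^3 = -1\<close>. As \<open>p - 1 = 3 * (2 * m + 1) + 1\<close>,
  Fermat gives \<open>1 = a^(p - 1) = - a\<close> modulo \<open>p\<close>, so \<open>a = -1\<close>
  and the quadratic takes the value 3, which \<open>p\<close> does not divide.\<close>

lemma prime_not_dvd_quadratic:
  fixes p a m :: nat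
  assumes "prime p" "p = 6 * m + 5"
  shows "\<not> int p dvd (int a)\<^sup>2 - int a + 1"
proof
  let ?a = "int a"
  assume dvd: "int p dvd ?a\<^sup>2 - ?a + 1"
  have cube: "[?a ^ 3 = -1] (mod int p)"
    using dvd by (rule dvd_quadratic_cube)
  have "\<not> p dvd a"
  proof
    assume "p dvd a"
    then have "int p dvd ?a"
      by simp
    then have "int p dvd ?a * (1 - ?a) + (?a\<^sup>2 - ?a + 1)"
      using dvd by (simp only: dvd_add dvd_mult2)
    then have "int p dvd 1"
      by (simp add: algebra_simps power2_eq_square)
    then show False
      using assms(2) by simp
  qed
  then have "[a ^ (p - 1) = 1] (mod p)"
    using assms(1) fermat_theorem by blast
  then have "[int (a ^ (p - 1)) = int 1] (mod int p)"
    by (simp only: cong_int_iff)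
  moreover have "int (a ^ (p - 1)) = (?a ^ 3) ^ (2 * m + 1) * ?a"
  proof -
    have "p - 1 = Suc (3 * (2 * m + 1))"
      using assms(2) by simp
    then show ?thesis
      by (simp only: of_nat_power of_nat_mult power_Suc2 power_mult)
  qed
  moreover have "[(?a ^ 3) ^ (2 * m + 1) * ?a = (- 1) ^ (2 * m + 1) * ?a] (mod int p)"
    using cube by (intro cong_mult cong_pow cong_refl)
  ultimately have "[- ?a = 1] (mod int p)"
    using cong_trans[OF cong_sym] by fastforce
  then have "int p dvd - (?a + 1)"
    by (simp add: cong_iff_dvd_diff)
  then have "int p dvd ?a + 1"
    by (simp only: dvd_minus_iff)
  then have "int p dvd (?a\<^sup>2 - ?a + 1) - (?a + 1) * (?a - 2)"
    using dvd by (simp only: dvd_diff dvd_mult2)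
  then have "int p dvd 3"
    by (simp add: algebra_simps power2_eq_square)
  then show False
    using assms(2) by (auto dest: zdvd_imp_le)
qed

section \<open>Quadratic roots, non-units and exceptional orbits modulo a prime power\<close>

context prime_power
begin

text \<open>The units modulo \<open>d\<close> form a cyclic group of order divisible by 6, so some
  \<open>x\<close> has order 6. In \<open>x^6 - 1 = (x^3 - 1) * (x + 1) * (x^2 - x + 1)\<close> the
  first two factors turn out to be units.\<close>

lemma exists_quadratic_root:
  assumes "p = 6 * m + 1"
  obtains w where "w \<in> {2..d - 1}" "int d dvd (int w)\<^sup>2 - int w + 1"
proof -
  have "m > 0"
    using assms prime by (intro Nat.gr0I) auto
  then have p: "odd p" "p > 3"
    using assms by auto
  obtain g where "\<forall>k>0. residue_primroot (p ^ k) g"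
    using residue_primroot_odd_prime_power_exists[OF prime p(1)] by blast
  then have g: "residue_primroot d g"
    using r d by simp
  \<comment> \<open>The order of \<open>g\<close> is \<open>p^(r - 1) * (p - 1) = 6 * t\<close>, so
    \<open>g ^ t\<close> has order 6.\<close>
  define t where "t = p ^ (r - 1) * m"
  have ord: "ord d g = 6 * t" and cop: "coprime d g"
    using g totient_prime_power[OF prime] r assms by (auto simp: residue_primroot_def d t_def)
  have t: "t > 0"
    using \<open>m > 0\<close> p by (simp add: t_def)
  define x where "x = int (g ^ t)"
  have pow: "int d dvd x ^ k - 1 \<longleftrightarrow> 6 dvd k" for k
  proof -
    have "int d dvd x ^ k - 1 \<longleftrightarrow> [g ^ (t * k) = 1] (mod d)"
      by (simp add: x_def power_mult flip: cong_iff_dvd_diff cong_int_iff)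
    also have "\<dots> \<longleftrightarrow> 6 * t dvd t * k"
      by (simp only: ord_divides ord)
    also have "\<dots> \<longleftrightarrow> 6 dvd k"
      using t by (simp add: mult.commute[of t])
    finally show ?thesis .
  qed
  have not3: "\<not> int p dvd 3" and not2: "\<not> int p dvd 2"
    using p by (auto dest: zdvd_imp_le)
  have "int d dvd (x ^ 3 + 1) * (x ^ 3 - 1)"
    using pow[of 6] by (simp add: algebra_simps flip: power_add)
  moreover have "\<not> int d dvd x ^ 3 - 1"
    using pow[of 3] by simp
  \<comment> \<open>Were \<open>x^3 + 1\<close> prime to \<open>p\<close>, cancelling it would leave
    \<open>d\<close> dividing \<open>x^3 - 1\<close>. So \<open>p\<close> divides
    \<open>x^3 + 1\<close>, hence not \<open>x^3 - 1\<close>, which differs from it by 2; the latter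
    can then be cancelled.\<close>
  ultimately have "int p dvd x ^ 3 + 1"
    using dvd_cancel[of "x ^ 3 - 1" "x ^ 3 + 1"] by (metis mult.commute)
  then have "\<not> int p dvd x ^ 3 - 1"
    using not2 dvd_diff[of "int p" "x ^ 3 + 1" "x ^ 3 - 1"] by auto
  then have "int d dvd x ^ 3 + 1"
    using \<open>int d dvd (x ^ 3 + 1) * (x ^ 3 - 1)\<close> dvd_cancel by blast
  then have prod: "int d dvd (x\<^sup>2 - x + 1) * (x + 1)"
    by (simp add: algebra_simps power2_eq_square power3_eq_cube)
  have not_x1: "\<not> int d dvd x + 1"
  proof
    assume "int d dvd x + 1"
    then have "int d dvd (x + 1) * (x - 1)"
      by simp
    then show False
      using pow[of 2] by (simp add: algebra_simps power2_eq_square)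
  qed
  \<comment> \<open>The same argument: otherwise \<open>p\<close> divides both factors, and
    therefore \<open>(x^2 - x + 1) - (x + 1) * (x - 2) = 3\<close>.\<close>
  have "\<not> int p dvd x + 1"
  proof
    assume p1: "int p dvd x + 1"
    have "int p dvd x\<^sup>2 - x + 1"
      using prod not_x1 dvd_cancel[of "x + 1" "x\<^sup>2 - x + 1"] by (metis mult.commute)
    then have "int p dvd (x\<^sup>2 - x + 1) - (x + 1) * (x - 2)"
      using p1 by (simp only: dvd_diff dvd_mult2)
    then show False
      using not3 by (simp add: algebra_simps power2_eq_square)
  qed
  then have root: "int d dvd x\<^sup>2 - x + 1"
    using prod dvd_cancel by blast
  define w where "w = residue d x"
  have iw: "int w = x mod int d"
    using d_pos by (simp add: w_def residue_def)
  have "[(int w)\<^sup>2 - int w + 1 = x\<^sup>2 - x + 1] (mod int d)"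
    unfolding iw by (intro cong_add cong_diff cong_pow cong_refl) simp_all
  then have "int d dvd (int w)\<^sup>2 - int w + 1"
    using root cong_dvd_iff by (metis cong_def dvd_eq_mod_eq_0)
  moreover have "w \<in> {2..d - 1}"
    unfolding w_def
  proof (rule residue_mem[OF d_pos])
    show "\<not> int d dvd x - 1"
      using pow[of 1] by simp
    show "\<not> int d dvd x"
    proof
      assume "int d dvd x"
      then have "int d dvd (x\<^sup>2 - x + 1) - x * (x - 1)"
        using root by (simp only: dvd_diff dvd_mult2)
      then show False
        using not_d_dvd_1 by (simp add: algebra_simps power2_eq_square)
    qed
  qed
  ultimately show ?thesis
    using that by blast
qed

text \<open>With \<open>q = d div p\<close> the elements are \<open>p * k\<close> and
  \<open>p * k + 1\<close> for \<open>1 \<le> k < q\<close>; \<open>k = 0\<close> would give the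
  omitted 0 and 1. The two families are disjoint.\<close>

lemma card_nonunits:
  "card {a \<in> {2..d - 1}. int p dvd int a \<or> int p dvd int a - 1} = 2 * (p ^ (r - 1) - 1)"
proof -
  define q where "q = p ^ (r - 1)"
  have dq: "d = p * q"
    using r by (simp add: d q_def flip: power_Suc)
  have p2: "2 \<le> p"
    using prime by (rule prime_ge_2_nat)
  have le: "p * k + 2 \<le> d" "2 \<le> p * k" if "k \<in> {1..<q}" for k
  proof -
    have "p * Suc k \<le> p * q"
      using that by (intro mult_le_mono2) simp
    then show "p * k + 2 \<le> d"
      using p2 dq by simp
    show "2 \<le> p * k"
      using p2 that by (metis atLeastLessThan_iff mult_le_mono nat_mult_1_right)
  qed
  have multiple: "\<exists>k\<in>{1..<q}. n = p * k" if "p dvd n" "1 \<le> n" "n < d" for n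
  proof -
    obtain k where k: "n = p * k"
      using \<open>p dvd n\<close> by (rule dvdE)
    then have "1 \<le> k" "k < q"
      using that p2 dq by (auto simp: Suc_le_eq)
    with k show ?thesis
      by auto
  qed
  have "{a \<in> {2..d - 1}. int p dvd int a \<or> int p dvd int a - 1}
      = (\<lambda>k. p * k) ` {1..<q} \<union> (\<lambda>k. p * k + 1) ` {1..<q}"
  proof (intro equalityI subsetI)
    fix a assume a: "a \<in> {a \<in> {2..d - 1}. int p dvd int a \<or> int p dvd int a - 1}"
    then have r: "2 \<le> a" "a < d"
      using d_gt_1 by auto
    have "int a - 1 = int (a - 1)"
      using r by simp
    then have "p dvd a \<or> p dvd a - 1"
      using a by (metis (lifting) mem_Collect_eq of_nat_dvd_iff)
    then show "a \<in> (\<lambda>k. p * k) ` {1..<q} \<union> (\<lambda>k. p * k + 1) ` {1..<q}"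
    proof
      assume "p dvd a"
      then show ?thesis
        using multiple[of a] r by auto
    next
      assume "p dvd a - 1"
      moreover have "1 \<le> a - 1" "a - 1 < d"
        using r by linarith+
      ultimately obtain k where "k \<in> {1..<q}" "a - 1 = p * k"
        using multiple by blast
      moreover from this have "a = p * k + 1"
        using r by linarith
      ultimately show ?thesis
        by blast
    qed
  next
    fix a assume "a \<in> (\<lambda>k. p * k) ` {1..<q} \<union> (\<lambda>k. p * k + 1) ` {1..<q}"
    then obtain k where "k \<in> {1..<q}" "a = p * k \<or> a = p * k + 1"
      by blast
    then show "a \<in> {a \<in> {2..d - 1}. int p dvd int a \<or> int p dvd int a - 1}"
      using le[of k] p2 by auto
  qed
  moreover have "(\<lambda>k. p * k) ` {1..<q} \<inter> (\<lambda>k. p * k + 1) ` {1..<q} = {}"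
  proof -
    have "p * k \<noteq> p * l + 1" for k l
      using p2 by (metis dvd_add_right_iff dvd_triv_left nat_dvd_1_iff_1 numeral_le_one_iff semiring_norm(69))
    then show ?thesis
      by blast
  qed
  moreover have "card ((\<lambda>k. p * k) ` {1..<q}) = q - 1" "card ((\<lambda>k. p * k + 1) ` {1..<q}) = q - 1"
    using p2 by (simp_all add: card_image inj_on_def)
  ultimately show ?thesis
    by (simp add: card_Un_disjoint q_def)
qed

text \<open>Puts \<open>2\<close> into the range and keeps \<open>2\<close>, \<open>-1\<close> and
  \<open>1/2\<close>, whose differences are 3 up to units, apart modulo \<open>d\<close>.\<close>

lemma odd_d_gt_3:
  assumes "odd p"
  shows "odd d" "3 < d"
proof -
  show "odd d"
    using assms by (simp add: d)
  have "3 \<le> p"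
    using prime_ge_2_nat[OF prime] assms by (cases "p = 2") auto
  then have "3 ^ 2 \<le> p ^ 2"
    by (rule power_mono) simp
  also have "p ^ 2 \<le> d"
    unfolding d using r prime_ge_2_nat[OF prime] by (intro power_increasing) auto
  finally show "3 < d"
    by simp
qed

text \<open>For \<open>a = 2\<close> the six fractions are \<open>2\<close>, \<open>-1\<close>,
  \<open>1/2\<close>, each occurring twice: the harmonic orbit.\<close>

lemma anharmonic_class_2:
  assumes "odd p"
  shows "anharmonic_class d 2 = {a \<in> {2..d - 1}.
      int d dvd int a - 2 \<or> int d dvd int a + 1 \<or> int d dvd 2 * int a - 1}"
    and "card (anharmonic_class d 2) = 3"
proof -
  have d3: "3 < int d" "odd (int d)"
    using odd_d_gt_3[OF assms] by simp_all
  \<comment> \<open>The inverse of 2 modulo the odd number \<open>d\<close>.\<close>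
  define h where "h = (int d + 1) div 2"
  have h: "int d = 2 * h - 1"
    unfolding h_def using d3(2) by presburger
  have small: "\<not> int d dvd k" if "k \<noteq> 0" "\<bar>k\<bar> \<le> 3" for k
    using that d3 dvd_imp_le_int[of k "int d"] by auto
  have inv: "int d dvd h * 2 - 1"
    by (simp add: h mult.commute)
  have iff: "anharmonic (int d) 2 b \<longleftrightarrow>
      int d dvd b - 2 \<or> int d dvd b + 1 \<or> int d dvd 2 * b - 1" for b
  proof -
    have "(1 - 2) * b - 1 = - (b + 1)" "2 * (1 - b) - 1 = - (2 * b - 1)" "(1 - 2) * (1 - b) - 1 = b - 2" "b - (1 - 2) = b + 1"
      by simp_all
    then show ?thesis
      unfolding anharmonic_alt by (metis dvd_minus_iff)
  qed
  show eq: "anharmonic_class d 2 = {a \<in> {2..d - 1}.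
      int d dvd int a - 2 \<or> int d dvd int a + 1 \<or> int d dvd 2 * int a - 1}"
    by (simp add: anharmonic_class_def iff)
  have "residue d 2 \<in> {2..d - 1}" "residue d (- 1) \<in> {2..d - 1}"
    by (rule residue_mem[OF d_pos]; rule small; simp)+
  moreover have "residue d h \<in> {2..d - 1}"
    by (rule residue_inverse_mem(1)[OF inv]; rule small; simp)
  ultimately have "anharmonic_class d 2 = {residue d 2, residue d (- 1), residue d h}"
    unfolding eq dvd_inverse_iff[OF inv] using residue_iff[of _ 2] residue_iff[of _ "- 1"] residue_iff[of _ h]
    by (auto simp del: atLeastAtMost_iff)
  moreover have "\<not> int d dvd 2 - (- 1)"
    using small[of 3] by simp
  moreover have "\<not> int d dvd 2 - h"
  proof
    assume "int d dvd 2 - h"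
    then have "int d dvd 2 * (2 - h) + (h * 2 - 1)"
      using inv by (simp only: dvd_add dvd_mult)
    then show False
      using small[of 3] by simp
  qed
  moreover have "\<not> int d dvd - 1 - h"
  proof
    assume "int d dvd - 1 - h"
    then have "int d dvd 2 * (- 1 - h) + (h * 2 - 1)"
      using inv by (simp only: dvd_add dvd_mult)
    then show False
      using small[of "- 3"] by simp
  qed
  ultimately show "card (anharmonic_class d 2) = 3"
    by (simp add: residue_eq_iff[OF d_pos])
qed

text \<open>As \<open>w * (1 - w) = 1\<close> modulo \<open>d\<close>, each of the six fractions is
  \<open>w\<close> or \<open>1 - w\<close>. Conversely \<open>a^2 - a + 1\<close> is congruent to
  \<open>(a - w) * (a - (1 - w))\<close>; the factors differ by \<open>2 * w - 1\<close>, whose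
  square is -3, so \<open>p\<close> does not divide both and \<open>d\<close> divides one.\<close>

lemma anharmonic_class_quadratic_root:
  assumes w: "w \<in> {2..d - 1}" "int d dvd (int w)\<^sup>2 - int w + 1" and p: "odd p" "p \<noteq> 3"
  shows "anharmonic_class d w = {a \<in> {2..d - 1}. int d dvd (int a)\<^sup>2 - int a + 1}"
    and "card (anharmonic_class d w) = 2"
proof -
  let ?w = "int w"
  have "int d dvd - (?w\<^sup>2 - ?w + 1)"
    using w(2) by (simp only: dvd_minus_iff)
  then have u: "int d dvd (1 - ?w) * ?w - 1" and v: "int d dvd ?w * (1 - ?w) - 1"
    by (simp_all add: algebra_simps power2_eq_square)
  have eq: "anharmonic_class d w = {residue d ?w, residue d (1 - ?w)}"
    unfolding anharmonic_class_unit[OF w(1) u v] by auto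
  have "\<not> int p dvd 3"
  proof
    assume "int p dvd 3"
    then have "p dvd 3"
      by (metis of_nat_dvd_iff of_nat_numeral)
    then show False
      using p(2) prime primes_dvd_imp_eq[of p 3] by simp
  qed
  moreover have "int p dvd 3" if "int p dvd 2 * ?w - 1"
  proof -
    have "int p dvd 4 * (?w\<^sup>2 - ?w + 1) - (2 * ?w - 1) * (2 * ?w - 1)"
      using that p_dvd[OF w(2)] by (simp only: dvd_diff dvd_mult dvd_mult2)
    then show ?thesis
      by (simp add: algebra_simps power2_eq_square)
  qed
  ultimately have not_p: "\<not> int p dvd 2 * ?w - 1"
    by blast
  have not_d: "\<not> int d dvd ?w - (1 - ?w)"
    using not_p p_dvd[of "2 * ?w - 1"] by auto
  then show "card (anharmonic_class d w) = 2"
    unfolding eq by (simp add: residue_eq_iff[OF d_pos])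
  have "int d dvd (int a)\<^sup>2 - int a + 1 \<longleftrightarrow> int d dvd int a - ?w \<or> int d dvd int a - (1 - ?w)" for a
  proof -
    have fact: "(int a)\<^sup>2 - int a + 1 = (int a - ?w) * (int a - (1 - ?w)) + (?w\<^sup>2 - ?w + 1)"
      by (simp add: algebra_simps power2_eq_square)
    have "int d dvd (int a)\<^sup>2 - int a + 1 \<longleftrightarrow> int d dvd (int a - ?w) * (int a - (1 - ?w))"
      unfolding fact using w(2) by (rule dvd_add_left_iff)
    also have "\<dots> \<longleftrightarrow> int d dvd int a - ?w \<or> int d dvd int a - (1 - ?w)"
    proof
      assume prod: "int d dvd (int a - ?w) * (int a - (1 - ?w))"
      have "\<not> (int p dvd int a - ?w \<and> int p dvd int a - (1 - ?w))"
      proof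
        assume "int p dvd int a - ?w \<and> int p dvd int a - (1 - ?w)"
        then have "int p dvd (int a - (1 - ?w)) - (int a - ?w)"
          by (blast intro: dvd_diff)
        then show False
          using not_p by simp
      qed
      then show "int d dvd int a - ?w \<or> int d dvd int a - (1 - ?w)"
        using prod dvd_cancel by (metis mult.commute)
    qed (auto simp: dvd_mult dvd_mult2)
    finally show ?thesis .
  qed
  then show "anharmonic_class d w = {a \<in> {2..d - 1}. int d dvd (int a)\<^sup>2 - int a + 1}"
    unfolding eq using residue_range_mem[OF w(1)] residue_iff[of _ ?w] residue_iff[of _ "1 - ?w"]
    by (auto simp del: atLeastAtMost_iff)
qed

end

section \<open>Counting the classes\<close>

locale prime_power_root = prime_power p r d for p r d :: nat +
  fixes e :: "'k::field"
  assumes root: "primitive_root_of_unity d e"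
begin

lemma class_image:
  assumes "a \<in> {2..d - 1}"
  shows "{(a, b). a \<in> {2..d - 1} \<and> b \<in> {2..d - 1} \<and> equivalent_actions d e a b} `` {a}
    = anharmonic_class d a"
  using assms equivalent_actions_iff_anharmonic[OF root] unfolding anharmonic_class_def by blast

lemma action_classes_eq: "action_classes d e = anharmonic_class d ` {2..d - 1}"
  unfolding action_classes_def quotient_def using class_image by auto

lemma finite_action_classes: "finite (action_classes d e)"
  by (simp add: action_classes_eq)

lemma card_classes_of_size:
  "k * card (classes_of_size d e k) = card {a \<in> {2..d - 1}. card (anharmonic_class d a) = k}"
proof -
  have "k * card (classes_of_size d e k) = card {a \<in> {2..d - 1}.
      card ({(a, b). a \<in> {2..d - 1} \<and> b \<in> {2..d - 1} \<and> equivalent_actions d e a b} `` {a}) = k}"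
    unfolding classes_of_size_def action_classes_def
    by (rule card_classes_of_card[OF _ equiv_equivalent_actions[OF root]]) simp
  also have "\<dots> = card {a \<in> {2..d - 1}. card (anharmonic_class d a) = k}"
    using class_image by (metis (no_types, lifting))
  finally show ?thesis .
qed

lemma anharmonic_class_eq:
  assumes "a \<in> {2..d - 1}" "b \<in> anharmonic_class d a"
  shows "anharmonic_class d b = anharmonic_class d a"
proof -
  have b: "b \<in> {2..d - 1}"
    using assms(2) by (simp add: anharmonic_class_def)
  have "(a, b) \<in> {(a, b). a \<in> {2..d - 1} \<and> b \<in> {2..d - 1} \<and> equivalent_actions d e a b}"
    using assms(2) class_image[OF assms(1)] by blast
  from equiv_class_eq[OF equiv_equivalent_actions[OF root] this] show ?thesis
    by (simp only: class_image[OF assms(1)] class_image[OF b])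
qed

text \<open>\<open>d + 1 - a\<close> is the natural number in the range representing
  \<open>1 - a\<close>. It exchanges the cases \<open>a = 1\<close> and \<open>a = 0\<close> modulo
  \<open>p\<close>.\<close>

lemma anharmonic_class_reflect:
  assumes "a \<in> {2..d - 1}"
  shows "d + 1 - a \<in> {2..d - 1}" "int (d + 1 - a) = int d + 1 - int a"
    "anharmonic_class d (d + 1 - a) = anharmonic_class d a"
proof -
  show 1: "d + 1 - a \<in> {2..d - 1}" and 2: "int (d + 1 - a) = int d + 1 - int a"
    using assms by auto
  have "anharmonic (int d) (int a) (int (d + 1 - a))"
    unfolding anharmonic_def 2 by simp
  with 1 have "d + 1 - a \<in> anharmonic_class d a"
    unfolding anharmonic_class_def by blast
  then show "anharmonic_class d (d + 1 - a) = anharmonic_class d a"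
    by (rule anharmonic_class_eq[OF assms])
qed

section \<open>Class sizes and counts for odd primes\<close>

lemma card_anharmonic_class_odd:
  assumes p: "odd p" and a: "a \<in> {2..d - 1}"
    and roots: "\<And>a. a \<in> {2..d - 1} \<Longrightarrow> int d dvd (int a)\<^sup>2 - int a + 1 \<Longrightarrow> card (anharmonic_class d a) = 2"
  shows "card (anharmonic_class d a) =
     (if int p dvd int a \<or> int p dvd int a - 1 then 4
      else if a \<in> anharmonic_class d 2 then 3
      else if int d dvd (int a)\<^sup>2 - int a + 1 then 2 else 6)"
proof -
  have p2: "\<not> int p dvd 2"
  proof
    assume "int p dvd 2"
    then have "p dvd 2"
      by (metis of_nat_dvd_iff of_nat_numeral)
    then show False
      using p prime primes_dvd_imp_eq[of p 2] by simp
  qed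
  \<comment> \<open>For odd \<open>p\<close> dividing \<open>b\<close>, the factor
    \<open>b - 2\<close> is a unit, so \<open>d\<close> would have to divide
    \<open>b\<close>.\<close>
  have nonunit: "card (anharmonic_class d b) = 4" if b: "b \<in> {2..d - 1}" "int p dvd int b" for b
  proof -
    have "\<not> int p dvd int b - 2"
      using b(2) p2 dvd_diff[of "int p" "int b" "int b - 2"] by auto
    then have "\<not> int d dvd int b * (int b - 2)"
      using dvd_cancel not_dvd_range(1)[OF b(1)] by blast
    then show ?thesis
      using card_anharmonic_class_nonunit[OF b] by simp
  qed
  have two: "2 \<in> {2..d - 1}"
    using odd_d_gt_3[OF p] by simp
  consider "int p dvd int a" | "int p dvd int a - 1" "\<not> int p dvd int a"
    | "\<not> int p dvd int a" "\<not> int p dvd int a - 1"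
    by blast
  then show ?thesis
  proof cases
    case 1
    then show ?thesis
      using nonunit[OF a] by simp
  next
    case 2
    have "int p dvd int d - (int a - 1)"
      using 2 p_dvd_d by (blast intro: dvd_diff)
    then have "int p dvd int (d + 1 - a)"
      unfolding anharmonic_class_reflect(2)[OF a] by (simp add: algebra_simps)
    then show ?thesis
      using nonunit[OF anharmonic_class_reflect(1)[OF a]] 2 anharmonic_class_reflect(3)[OF a] by simp
  next
    case 3
    show ?thesis
    proof (cases "a \<in> anharmonic_class d 2")
      case True
      then show ?thesis
        using 3 anharmonic_class_eq[OF two True] anharmonic_class_2(2)[OF p] by simp
    next
      case False
      then have "\<not> int d dvd 2 * int a - 1" "\<not> int d dvd int a + 1" "\<not> int d dvd int a - 2"
        using a unfolding anharmonic_class_2(1)[OF p] by blast+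
      then show ?thesis
        using 3 False roots[OF a] card_anharmonic_class_unit[OF a 3] by simp
    qed
  qed
qed

text \<open>The range splits into \<open>N\<close>, the harmonic orbit, \<open>R\<close> and the
  rest, with classes of 4, 3, 2 and 6 elements; dividing numbers of elements by class sizes counts
  the classes. The residue of \<open>p\<close> modulo 6 enters only through \<open>roots\<close> and
  \<open>card R\<close>.\<close>

lemma odd_counts:
  assumes p: "odd p"
    and roots: "\<And>a. a \<in> {2..d - 1} \<Longrightarrow> int d dvd (int a)\<^sup>2 - int a + 1 \<Longrightarrow> card (anharmonic_class d a) = 2"
  defines "R \<equiv> {a \<in> {2..d - 1}. int d dvd (int a)\<^sup>2 - int a + 1}"
  shows "action_classes d e = classes_of_size d e 3 \<union> classes_of_size d e 2 \<union>
      classes_of_size d e 4 \<union> classes_of_size d e 6"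
    and "card (classes_of_size d e 3) = 1"
    and "2 * card (classes_of_size d e 2) = card R"
    and "real (card (classes_of_size d e 4)) = (real d - real p) / (2 * real p)"
    and "6 * real (card (classes_of_size d e 6)) =
      (real d * real p - 2 * real d - 3 * real p) / real p - real (card R)"
proof -
  let ?A = "{2..d - 1}" and ?f = "\<lambda>a. card (anharmonic_class d a)"
  define N where "N = {a \<in> ?A. int p dvd int a \<or> int p dvd int a - 1}"
  define q where "q = p ^ (r - 1)"
  have dq: "d = p * q"
    using r by (simp add: d q_def flip: power_Suc)
  have pq: "p > 0" "q > 0"
    using d_pos dq by auto
  have f: "?f a = (if a \<in> N then 4 else if a \<in> anharmonic_class d 2 then 3
      else if a \<in> R then 2 else 6)" if "a \<in> ?A" for a
    using card_anharmonic_class_odd[OF p that roots] that by (simp add: N_def R_def)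
  have two: "2 \<in> ?A"
    using odd_d_gt_3[OF p] by simp
  have T: "?f a = 3" if "a \<in> anharmonic_class d 2" for a
    using anharmonic_class_eq[OF two that] anharmonic_class_2(2)[OF p] by simp
  have T_sub: "anharmonic_class d 2 \<subseteq> ?A"
    by (auto simp: anharmonic_class_def)
  have R: "?f a = 2" if "a \<in> R" for a
    using that roots by (simp add: R_def)
  have RN: "R \<subseteq> ?A" "N \<subseteq> ?A"
    by (auto simp: R_def N_def)
  have iff: "?f a = 4 \<longleftrightarrow> a \<in> N" "?f a = 3 \<longleftrightarrow> a \<in> anharmonic_class d 2"
    "?f a = 2 \<longleftrightarrow> a \<in> R" "?f a = 6 \<longleftrightarrow> a \<notin> N \<union> anharmonic_class d 2 \<union> R"
    if "a \<in> ?A" for a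
    using f[OF that] T[of a] R[of a] by (auto split: if_splits)
  have f4: "{a \<in> ?A. ?f a = 4} = N" and f3: "{a \<in> ?A. ?f a = 3} = anharmonic_class d 2"
    and f2: "{a \<in> ?A. ?f a = 2} = R"
    using iff RN T_sub by blast+
  have f6: "{a \<in> ?A. ?f a = 6} = ?A - (N \<union> anharmonic_class d 2 \<union> R)"
    using iff(4) by blast
  \<comment> \<open>The sets are level sets of one function, hence disjoint.\<close>
  have "N \<inter> anharmonic_class d 2 = {}" "(N \<union> anharmonic_class d 2) \<inter> R = {}"
    unfolding f4[symmetric] f3[symmetric] f2[symmetric] by auto
  moreover have fin: "finite N" "finite R" "finite (anharmonic_class d 2)"
    using RN T_sub by (auto intro: finite_subset)
  ultimately have "card (N \<union> anharmonic_class d 2 \<union> R) = card N + 3 + card R"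
    by (simp add: card_Un_disjoint anharmonic_class_2(2)[OF p])
  moreover have "N \<union> anharmonic_class d 2 \<union> R \<subseteq> ?A"
    using RN T_sub by blast
  ultimately have f6: "card {a \<in> ?A. ?f a = 6} + (card N + 3 + card R) = d - 2"
    using fin card_mono[of ?A "N \<union> anharmonic_class d 2 \<union> R"]
    unfolding f6 by (simp add: card_Diff_subset)
  have N: "card N = 2 * (q - 1)"
    unfolding N_def q_def by (rule card_nonunits)
  show "action_classes d e = classes_of_size d e 3 \<union> classes_of_size d e 2 \<union>
      classes_of_size d e 4 \<union> classes_of_size d e 6"
    using iff by (auto simp: classes_of_size_def action_classes_eq simp del: atLeastAtMost_iff)
  show "card (classes_of_size d e 3) = 1"
    using card_classes_of_size[of 3] unfolding f3 anharmonic_class_2(2)[OF p] by simp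
  show "2 * card (classes_of_size d e 2) = card R"
    using card_classes_of_size[of 2] unfolding f2 .
  have "2 * card (classes_of_size d e 4) = q - 1"
    using card_classes_of_size[of 4] unfolding f4 N by simp
  then have "2 * real (card (classes_of_size d e 4)) = real q - 1"
    using pq by (metis Suc_leI of_nat_1 of_nat_diff of_nat_mult of_nat_numeral One_nat_def)
  then have "real (card (classes_of_size d e 4)) = (real q - 1) / 2"
    by simp
  also have "\<dots> = (real d - real p) / (2 * real p)"
    using pq by (simp add: dq field_simps)
  finally show "real (card (classes_of_size d e 4)) = (real d - real p) / (2 * real p)" .
  \<comment> \<open>Of the \<open>d - 2\<close> elements of the range, \<open>2 * (q - 1)\<close>, 3
    and \<open>card R\<close> lie in classes of other sizes.\<close>
  have "6 * card (classes_of_size d e 6) + (2 * (q - 1) + 3 + card R) = d - 2"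
    using f6 unfolding card_classes_of_size N .
  then have "6 * card (classes_of_size d e 6) + 2 * q + 3 + card R = d"
    using pq odd_d_gt_3(2)[OF p] by linarith
  then have "6 * real (card (classes_of_size d e 6)) = (real d - 2 * real q - 3) - real (card R)"
    by linarith
  also have "real d - 2 * real q - 3 = (real d * real p - 2 * real d - 3 * real p) / real p"
    using pq by (simp add: dq field_simps)
  finally show "6 * real (card (classes_of_size d e 6)) =
      (real d * real p - 2 * real d - 3 * real p) / real p - real (card R)" .
qed

text \<open>There are no quadratic roots: 9 divides \<open>d\<close> if \<open>p = 3\<close>, and
  Fermat excludes them modulo a prime of the form \<open>6 * n - 1\<close>. So no class has two
  elements.\<close>

lemma classes_3_or_5_mod_6:
  assumes "p = 3 \<or> (\<exists>n::int. int p = 6 * n - 1)"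
  shows "action_classes d e =
          classes_of_size d e 3 \<union> classes_of_size d e 4 \<union> classes_of_size d e 6"
    and "card (classes_of_size d e 3) = 1"
    and "real (card (classes_of_size d e 4)) = (real d - real p) / (2 * real p)"
    and "real (card (classes_of_size d e 6)) =
          (real d * real p - 2 * real d - 3 * real p) / (6 * real p)"
proof -
  have no_root: "\<not> int d dvd (int a)\<^sup>2 - int a + 1" for a
    using assms
  proof
    assume "p = 3"
    then have "3 ^ 2 dvd d"
      using r by (simp only: d le_imp_power_dvd)
    then have "9 dvd int d"
      using of_nat_dvd_iff[of 9 d] by simp
    then show ?thesis
      using nine_not_dvd_quadratic dvd_trans by blast
  next
    assume "\<exists>n::int. int p = 6 * n - 1"
    then obtain n :: int where "int p = 6 * n - 1" ..
    \<comment> \<open>\<open>6 * n - 1 = 6 * (n - 1) + 5\<close>, and \<open>n \<ge> 1\<close>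
      because \<open>p\<close> is positive.\<close>
    then have "p = 6 * nat (n - 1) + 5"
      using prime_ge_2_nat[OF prime] by linarith
    then show ?thesis
      using prime_not_dvd_quadratic[OF prime] p_dvd by blast
  qed
  have "odd p"
    using assms by (auto, presburger)
  note counts = odd_counts[OF this]
  have pos: "real p > 0"
    using prime_gt_0_nat[OF prime] by simp
  have "card (classes_of_size d e 2) = 0"
    using counts(3) no_root by simp
  then have "classes_of_size d e 2 = {}"
    using finite_action_classes by (simp add: classes_of_size_def)
  then show "action_classes d e =
          classes_of_size d e 3 \<union> classes_of_size d e 4 \<union> classes_of_size d e 6"
    using counts(1) no_root by simp
  show "card (classes_of_size d e 3) = 1"
    using counts(2) no_root by simp
  show "real (card (classes_of_size d e 4)) = (real d - real p) / (2 * real p)"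
    using counts(4) no_root by simp
  show "real (card (classes_of_size d e 6)) =
          (real d * real p - 2 * real d - 3 * real p) / (6 * real p)"
    using counts(5) no_root pos by (simp add: field_simps)
qed

text \<open>The quadratic roots form a single class of two elements; they turn the 3 of the general
  count into the 5 of the last formula.\<close>

lemma classes_1_mod_6:
  assumes "\<exists>n::int. int p = 6 * n + 1"
  shows "action_classes d e =
          classes_of_size d e 3 \<union> classes_of_size d e 2 \<union>
          classes_of_size d e 4 \<union> classes_of_size d e 6"
    and "card (classes_of_size d e 3) = 1"
    and "card (classes_of_size d e 2) = 1"
    and "real (card (classes_of_size d e 4)) = (real d - real p) / (2 * real p)"
    and "real (card (classes_of_size d e 6)) =
          (real d * real p - 2 * real d - 5 * real p) / (6 * real p)"
proof -
  obtain n :: int where n: "int p = 6 * n + 1"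
    using assms ..
  then have "p = 6 * nat n + 1"
    by linarith
  then obtain w where w: "w \<in> {2..d - 1}" "int d dvd (int w)\<^sup>2 - int w + 1"
    using exists_quadratic_root by blast
  have p: "odd p" "p \<noteq> 3"
    using n by presburger+
  have pos: "real p > 0"
    using prime_gt_0_nat[OF prime] by simp
  note class_w = anharmonic_class_quadratic_root[OF w p]
  have roots: "card (anharmonic_class d a) = 2"
    if "a \<in> {2..d - 1}" "int d dvd (int a)\<^sup>2 - int a + 1" for a
    using anharmonic_class_eq[OF w(1), of a] class_w that by auto
  note counts = odd_counts[OF p(1) roots]
  show "action_classes d e =
          classes_of_size d e 3 \<union> classes_of_size d e 2 \<union>
          classes_of_size d e 4 \<union> classes_of_size d e 6"
    by (rule counts(1))
  show "card (classes_of_size d e 3) = 1"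
    by (rule counts(2))
  show "card (classes_of_size d e 2) = 1"
    using counts(3) class_w by simp
  show "real (card (classes_of_size d e 4)) = (real d - real p) / (2 * real p)"
    by (rule counts(4))
  show "real (card (classes_of_size d e 6)) =
          (real d * real p - 2 * real d - 5 * real p) / (6 * real p)"
    using counts(5) pos unfolding class_w(1)[symmetric] class_w(2) by (simp add: field_simps)
qed

section \<open>Powers of two\<close>

lemma classes_4:
  assumes "p = 2" "r = 2"
  shows "card (action_classes d e) = 1"
proof -
  have A: "{2..d - 1} = {2, 3}"
    using assms by (auto simp: d)
  \<comment> \<open>\<open>3 = 1 - 2\<close> modulo 4.\<close>
  have "3 \<in> anharmonic_class d 2"
    using assms by (simp add: anharmonic_class_def anharmonic_def d)
  then have "anharmonic_class d 3 = anharmonic_class d 2"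
    using A by (intro anharmonic_class_eq) auto
  then show ?thesis
    unfolding action_classes_eq A by simp
qed

text \<open>With \<open>a = 2 * c\<close> and \<open>d = 4 * s\<close> the condition is that
  \<open>s\<close> divides \<open>c * (c - 1)\<close>. One of these neighbours is odd, so the power
  of two \<open>s\<close> divides the other, and \<open>1 \<le> c < 2 * s\<close> leaves
  \<open>c = s\<close>, \<open>c = 1\<close> or \<open>c = s + 1\<close>.\<close>

lemma even_self_reflected_iff:
  assumes "p = 2" "r > 2" "a \<in> {2..d - 1}" "even a"
  shows "int d dvd int a * (int a - 2) \<longleftrightarrow> a \<in> {2, d div 2, d div 2 + 2}"
proof -
  define s where "s = (2::nat) ^ (r - 2)"
  have "d = 2 ^ (2 + (r - 2))"
    by (simp only: d assms(1) le_add_diff_inverse[OF r])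
  then have d4: "d = 4 * s"
    by (simp only: power_add s_def) simp
  obtain c where c: "a = 2 * c"
    using assms(4) by (rule evenE)
  have c_range: "1 \<le> c" "c < 2 * s"
    using assms(3) c d4 by auto
  have prod: "int a * (int a - 2) = 4 * int (c * (c - 1))"
    using c c_range by (simp add: algebra_simps of_nat_diff)
  have "int d dvd int a * (int a - 2) \<longleftrightarrow> s dvd c * (c - 1)"
    unfolding prod d4 using of_nat_dvd_iff[of "4 * s" "4 * (c * (c - 1))", where 'a = int] by simp
  also have "\<dots> \<longleftrightarrow> s dvd c \<or> s dvd c - 1"
  proof
    assume "s dvd c * (c - 1)"
    moreover have "coprime s c \<or> coprime s (c - 1)"
      using c_range by (cases "even c") (auto simp: s_def)
    ultimately show "s dvd c \<or> s dvd c - 1"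
      by (auto simp: coprime_dvd_mult_left_iff coprime_dvd_mult_right_iff)
  qed auto
  also have "\<dots> \<longleftrightarrow> c = s \<or> c = 1 \<or> c = s + 1"
  proof -
    have dvd_iff: "s dvd k \<longleftrightarrow> k = 0 \<or> k = s" if "k < 2 * s" for k
    proof
      assume "s dvd k"
      then obtain j where "k = s * j" ..
      moreover from this have "j < 2"
        using that by (metis mult.commute mult_less_cancel2)
      ultimately show "k = 0 \<or> k = s"
        by (auto simp: less_2_cases_iff)
    qed auto
    show ?thesis
      using dvd_iff[of c] dvd_iff[of "c - 1"] c_range by auto
  qed
  also have "\<dots> \<longleftrightarrow> a \<in> {2, d div 2, d div 2 + 2}"
    unfolding c d4 by auto
  finally show ?thesis .
qed

text \<open>Every \<open>a\<close> is 0 or 1 modulo 2, so only two and four occur as sizes. The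
  elements \<open>2\<close>, \<open>d/2\<close>, \<open>d/2 + 2\<close> and their reflections make
  up three classes of two; the other \<open>d - 8\<close> elements form \<open>d/4 - 2\<close>
  classes of four.\<close>

lemma classes_power_of_2:
  assumes p: "p = 2" and r2: "r > 2"
  shows "real (card (action_classes d e)) = real d / 4 + 1"
    and "\<exists>T \<subseteq> action_classes d e. card T = 3 \<and>
           (\<forall>C\<in>T. card C = 2) \<and> (\<forall>C\<in>action_classes d e - T. card C = 4)"
proof -
  let ?A = "{2..d - 1}" and ?f = "\<lambda>a. card (anharmonic_class d a)"
  let ?h = "d div 2"
  \<comment> \<open>Divisibility by 8 makes \<open>?h\<close> even, so \<open>2\<close>,
    \<open>?h\<close>, \<open>?h + 2\<close> are even and their reflections odd.\<close>
  have "2 ^ 3 dvd d"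
    using r2 by (simp only: d p le_imp_power_dvd)
  then obtain k where k: "d = 8 * k"
    by (auto elim: dvdE)
  then have k0: "k > 0"
    using d_pos by simp
  have even: "?f a = (if a \<in> {2, ?h, ?h + 2} then 2 else 4)" if "a \<in> ?A" "even a" for a
    using card_anharmonic_class_nonunit[OF that(1)] even_self_reflected_iff[OF p r2 that] that(2) p by simp
  \<comment> \<open>The reflection \<open>d + 1 - a\<close> swaps parity and takes \<open>2\<close>,
    \<open>?h\<close>, \<open>?h + 2\<close> to \<open>d - 1\<close>, \<open>?h + 1\<close>,
    \<open>?h - 1\<close>.\<close>
  have odd: "?f a = (if a \<in> {d - 1, ?h + 1, ?h - 1} then 2 else 4)" if a: "a \<in> ?A" "odd a" for a
  proof -
    have "even (d + 1 - a)"
      using a k by auto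
    then have "?f a = (if d + 1 - a \<in> {2, ?h, ?h + 2} then 2 else 4)"
      using even[OF anharmonic_class_reflect(1)[OF a(1)]] anharmonic_class_reflect(3)[OF a(1)] by simp
    also have "d + 1 - a \<in> {2, ?h, ?h + 2} \<longleftrightarrow> a \<in> {d - 1, ?h + 1, ?h - 1}"
      using a(1) k k0 by auto
    finally show ?thesis .
  qed
  have f: "?f a = 2 \<or> ?f a = 4" if "a \<in> ?A" for a
    using even[OF that] odd[OF that] by (cases "even a") (auto split: if_splits)
  have "{a \<in> ?A. ?f a = 2} = {2, ?h, ?h + 2} \<union> {d - 1, ?h + 1, ?h - 1}"
  proof -
    have "?f a = 2 \<longleftrightarrow> a \<in> {2, ?h, ?h + 2} \<union> {d - 1, ?h + 1, ?h - 1}" if "a \<in> ?A" for a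
    proof (cases "even a")
      case True
      moreover from this have "a \<notin> {d - 1, ?h + 1, ?h - 1}"
        using k k0 by auto
      ultimately show ?thesis
        using even[OF that] by auto
    next
      case False
      moreover from this have "a \<notin> {2, ?h, ?h + 2}"
        using k by auto
      ultimately show ?thesis
        using odd[OF that] by auto
    qed
    moreover have "{2, ?h, ?h + 2} \<union> {d - 1, ?h + 1, ?h - 1} \<subseteq> ?A"
      using k k0 by auto
    ultimately show ?thesis
      by blast
  qed
  moreover have "card ({2, ?h, ?h + 2} \<union> {d - 1, ?h + 1, ?h - 1}) = 6"
  proof -
    \<comment> \<open>Writing \<open>k\<close> as a successor removes the subtractions, so the six
      elements become linear terms in \<open>j\<close> with visibly different values.\<close>
    obtain j where "k = Suc j"
      using k0 gr0_implies_Suc by blast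
    then have eq: "?h = 4 * j + 4" "4 * j + 4 + 2 = 4 * j + 6" "d - 1 = 8 * j + 7"
        "4 * j + 4 + 1 = 4 * j + 5" "4 * j + 4 - 1 = 4 * j + 3"
      using k by simp_all
    have "distinct [2, 4 * j + 4, 4 * j + 6, 8 * j + 7, 4 * j + 5, 4 * j + 3]"
      by auto
    then have "card (set [2, 4 * j + 4, 4 * j + 6, 8 * j + 7, 4 * j + 5, 4 * j + 3]) = 6"
      by (subst distinct_card) simp_all
    then show ?thesis
      unfolding eq by (simp only: list.set Un_insert_left Un_empty_left)
  qed
  ultimately have f2: "card {a \<in> ?A. ?f a = 2} = 6"
    by simp
  have "{a \<in> ?A. ?f a = 4} = ?A - {a \<in> ?A. ?f a = 2}"
    using f by fastforce
  moreover have "card (?A - {a \<in> ?A. ?f a = 2}) = card ?A - card {a \<in> ?A. ?f a = 2}"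
    by (rule card_Diff_subset) auto
  ultimately have f4: "card {a \<in> ?A. ?f a = 4} = card ?A - 6"
    by (simp only: f2)
  have c2: "card (classes_of_size d e 2) = 3"
    using card_classes_of_size[of 2] unfolding f2 by simp
  \<comment> \<open>The range has \<open>d - 2 = 8 * k - 2\<close> elements, six of them in classes
    of two.\<close>
  have c4: "4 * card (classes_of_size d e 4) = 8 * k - 8"
    using card_classes_of_size[of 4] unfolding f4 by (simp add: k)
  have union: "action_classes d e = classes_of_size d e 2 \<union> classes_of_size d e 4"
    using f unfolding classes_of_size_def action_classes_eq by blast
  have "card (action_classes d e) = card (classes_of_size d e 2) + card (classes_of_size d e 4)"
    unfolding union using finite_action_classes
    by (intro card_Un_disjoint) (auto simp: classes_of_size_def)
  then have "card (action_classes d e) = 2 * k + 1"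
    using c2 c4 k0 by linarith
  then show "real (card (action_classes d e)) = real d / 4 + 1"
    using k by simp
  have "classes_of_size d e 2 \<subseteq> action_classes d e" "\<forall>C\<in>classes_of_size d e 2. card C = 2"
    "\<forall>C\<in>action_classes d e - classes_of_size d e 2. card C = 4"
    using union by (auto simp: classes_of_size_def)
  with c2 show "\<exists>T \<subseteq> action_classes d e. card T = 3 \<and>
           (\<forall>C\<in>T. card C = 2) \<and> (\<forall>C\<in>action_classes d e - T. card C = 4)"
    by blast
qed

end

theorem theorem5p16:
  fixes e :: "'k::{alg_closed_field, field_char_0}"
    and d p r :: nat
  assumes "prime p" and "r \<ge> 2" and "d = p ^ r"
    and "primitive_root_of_unity d e"
  shows
    "(p = 2 \<and> r = 2 \<longrightarrow> card (action_classes d e) = 1) \<and>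
     (p = 2 \<and> r > 2 \<longrightarrow>
        real (card (action_classes d e)) = real d / 4 + 1 \<and>
        (\<exists>T \<subseteq> action_classes d e. card T = 3 \<and>
           (\<forall>C\<in>T. card C = 2) \<and> (\<forall>C\<in>action_classes d e - T. card C = 4))) \<and>
     (p = 3 \<or> (\<exists>n::int. int p = 6 * n - 1) \<longrightarrow>
        action_classes d e =
          classes_of_size d e 3 \<union> classes_of_size d e 4 \<union> classes_of_size d e 6 \<and>
        card (classes_of_size d e 3) = 1 \<and>
        real (card (classes_of_size d e 4)) = (real d - real p) / (2 * real p) \<and>
        real (card (classes_of_size d e 6)) =
          (real d * real p - 2 * real d - 3 * real p) / (6 * real p)) \<and>
     ((\<exists>n::int. int p = 6 * n + 1) \<longrightarrow>
        action_classes d e =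
          classes_of_size d e 3 \<union> classes_of_size d e 2 \<union>
          classes_of_size d e 4 \<union> classes_of_size d e 6 \<and>
        card (classes_of_size d e 3) = 1 \<and>
        card (classes_of_size d e 2) = 1 \<and>
        real (card (classes_of_size d e 4)) = (real d - real p) / (2 * real p) \<and>
        real (card (classes_of_size d e 6)) =
          (real d * real p - 2 * real d - 5 * real p) / (6 * real p))"
proof -
  interpret prime_power_root p r d e
    by unfold_locales (use assms in auto)
  show ?thesis
    by (intro conjI impI; (elim conjE)?)
      (fact classes_4 classes_power_of_2 classes_3_or_5_mod_6 classes_1_mod_6)+
qed

end
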